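(* Suppose $\hat{\Omega}_{1:r}$ is a $(1+\epsilon)$ k-means solution. Let $\epsilon_{Agg}^2 := \alpha_{\mathbf{A}}^2 \epsilon_{\mathbf{A}}^2 + \alpha_{\mathbf{B}}^2 \epsilon_{\mathbf{B}}^2 + \alpha_{\mathbf{T}}^2 \epsilon_{\mathbf{T}}^2$. Then, if $\operatorname{rank}(\bar{\boldsymbol{\Phi}}) = r$ and $\epsilon_{Agg} \leq \frac{\sigma_r(\bar{\boldsymbol{\Phi}}) \sqrt{|\Omega_{(r)}| + |\Omega_{(1)}|}}{8 \sqrt{ (2+\epsilon) |\Omega_{(1)}|}}$, we have \[ \textup{MR}(\hat{\Omega}_{1:r}) \leq 64(2+\epsilon)\, \sigma_r(\bar{\boldsymbol{\Phi}})^{-2}\, \epsilon_{Agg}^2. \] Additionally, if $\epsilon_{Agg} \leq \frac{\sigma_r(\bar{\boldsymbol{\Phi}})}{8 \sqrt{ (2+\epsilon) |\Omega_{(1)}|}}$, then $\textup{MR}(\hat{\Omega}_{1:r}) = 0$.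
   Context: Consider a Markov jump linear system (MJS) $\mathbf{x}_{t+1} = \mathbf{A}_{\omega_t}\mathbf{x}_t + \mathbf{B}_{\omega_t}\mathbf{u}_t$ with $s$ modes, $\mathbf{A}_i\in\mathbb{R}^{n\times n}$, $\mathbf{B}_i\in\mathbb{R}^{n\times p}$, and mode $\omega_t\in[s]$ evolving as an ergodic Markov chain with transition matrix $\mathbf{T}\in\mathbb{R}^{s\times s}$, $\mathbf{T}(i,j)=\mathbb{P}(\omega_{t+1}=j\mid\omega_t=i)$. Suppose there is a (hidden) partition $\Omega_{1:r}$ of $[s]$ into $r$ nonempty disjoint sets and $\epsilon_{\mathbf{A}},\epsilon_{\mathbf{B}},\epsilon_{\mathbf{T}}\ge0$ with $\sum_{k\in[r]}\sum_{i,i'\in\Omega_k}\|\mathbf{A}_i-\mathbf{A}_{i'}\|_F\le\epsilon_{\mathbf{A}}$, $\sum_{k\in[r]}\sum_{i,i'\in\Omega_k}\|\mathbf{B}_i-\mathbf{B}_{i'}\|_F\le\epsilon_{\mathbf{B}}$, and $\sum_{k\in[r]}\sum_{i,i'\in\Omega_k}\|\mathbf{T}(i,:)^\top-\mathbf{T}(i',:)^\top\|_1\le\epsilon_{\mathbf{T}}$ (approximately aggregatable case). Given nonnegative weights $\alpha_{\mathbf{A}},\alpha_{\mathbf{B}},\alpha_{\mathbf{T}}$ summing to 1, form the feature matrix $\boldsymbol{\Phi}$ with rows $\boldsymbol{\Phi}(i,:)=[\alpha_{\mathbf{A}}\mathrm{vec}(\mathbf{A}_i)^\top,\alpha_{\mathbf{B}}\mathrm{vec}(\mathbf{B}_i)^\top,\alpha_{\mathbf{T}}\mathbf{T}(i,:)]$;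 let $\mathbf{U}_r$ be its top-$r$ left singular vectors, and let $\hat{\Omega}_{1:r}$ be obtained by k-means on the rows of $\mathbf{U}_r$, where a $(1+\epsilon)$ k-means solution means its k-means objective is at most $(1+\epsilon)$ times the optimal one. Define the averaged matrix $\bar{\boldsymbol{\Phi}}$ by $\bar{\boldsymbol{\Phi}}(i,:)=\frac{1}{|\Omega_k|}\sum_{i'\in\Omega_k}\boldsymbol{\Phi}(i',:)$ for $i\in\Omega_k$. The misclustering rate is $\textup{MR}(\hat{\Omega}_{1:r})=\min_{h}\sum_{k\in[r]}\frac{|\{i:i\in\Omega_k,i\notin\hat{\Omega}_{h(k)}\}|}{|\Omega_k|}$, minimized over bijections $h:[r]\to[r]$. $\Omega_{(i)}$ denotes the cluster with $i$-th largest cardinality and $\sigma_r(\cdot)$ the $r$-th largest singular value. *)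

theory Defs
  imports "Jordan_Normal_Form.Char_Poly" "Jordan_Normal_Form.DL_Rank"
begin

text \<open>Conventions: modes are 0..<s, clusters are 0..<r, matrices are JNF matrices.\<close>

definition fro_norm :: "real mat \<Rightarrow> real" where
  "fro_norm M = sqrt (\<Sum>i<dim_row M. \<Sum>j<dim_col M. (M $$ (i,j))^2)"

definition row_l1_dist :: "real mat \<Rightarrow> nat \<Rightarrow> nat \<Rightarrow> real" where
  "row_l1_dist T i i' = (\<Sum>j<dim_col T. \<bar>T $$ (i,j) - T $$ (i',j)\<bar>)"

definition sing_vals :: "real mat \<Rightarrow> real list" where
  "sing_vals M = map sqrt (rev (sorted_list_of_multiset (proots (char_poly (M * M\<^sup>T)))))"

definition sing_val :: "real mat \<Rightarrow> nat \<Rightarrow> real" where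
  "sing_val M k = sing_vals M ! (k - 1)"

definition mat_rank :: "real mat \<Rightarrow> nat" where
  "mat_rank M = vec_space.rank (dim_row M) M"

text \<open>Ergodic Markov chain transition matrix on s states (stochastic and primitive,
  i.e. irreducible and aperiodic).\<close>
definition ergodic_transition :: "nat \<Rightarrow> real mat \<Rightarrow> bool" where
  "ergodic_transition s T \<longleftrightarrow> T \<in> carrier_mat s s
     \<and> (\<forall>i<s. \<forall>j<s. 0 \<le> T $$ (i,j))
     \<and> (\<forall>i<s. (\<Sum>j<s. T $$ (i,j)) = 1)
     \<and> (\<exists>m>0. \<forall>i<s. \<forall>j<s. 0 < (T ^\<^sub>m m) $$ (i,j))"

definition is_partition :: "nat \<Rightarrow> nat \<Rightarrow> (nat \<Rightarrow> nat set) \<Rightarrow> bool" where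
  "is_partition s r Om \<longleftrightarrow> (\<forall>k<r. Om k \<noteq> {})
     \<and> (\<forall>k<r. \<forall>k'<r. k \<noteq> k' \<longrightarrow> Om k \<inter> Om k' = {})
     \<and> (\<Union>k<r. Om k) = {..<s}"

definition clus_of :: "nat \<Rightarrow> (nat \<Rightarrow> nat set) \<Rightarrow> nat \<Rightarrow> nat" where
  "clus_of r Om i = (THE k. k < r \<and> i \<in> Om k)"

text \<open>Feature matrix: row i = [aA vec(A_i)^T, aB vec(B_i)^T, aT T(i,:)], vec = column stacking.\<close>
definition feature_mat :: "nat \<Rightarrow> nat \<Rightarrow> nat \<Rightarrow> real \<Rightarrow> real \<Rightarrow> real \<Rightarrow>
    (nat \<Rightarrow> real mat) \<Rightarrow> (nat \<Rightarrow> real mat) \<Rightarrow> real mat \<Rightarrow> real mat" where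
  "feature_mat s n p aA aB aT A B T = mat s (n*n + n*p + s) (\<lambda>(i,j).
     if j < n*n then aA * A i $$ (j mod n, j div n)
     else if j < n*n + n*p then aB * B i $$ ((j - n*n) mod n, (j - n*n) div n)
     else aT * T $$ (i, j - n*n - n*p))"

definition averaged_mat :: "nat \<Rightarrow> (nat \<Rightarrow> nat set) \<Rightarrow> real mat \<Rightarrow> real mat" where
  "averaged_mat r Om Phi = mat (dim_row Phi) (dim_col Phi) (\<lambda>(i,j).
     (\<Sum>i'\<in>Om (clus_of r Om i). Phi $$ (i',j)) / real (card (Om (clus_of r Om i))))"

definition top_left_sing_vecs :: "nat \<Rightarrow> real mat \<Rightarrow> real mat \<Rightarrow> bool" where
  "top_left_sing_vecs r Phi U \<longleftrightarrow> U \<in> carrier_mat (dim_row Phi) r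
     \<and> U\<^sup>T * U = 1\<^sub>m r
     \<and> (\<forall>j<r. (Phi * Phi\<^sup>T) *\<^sub>v col U j = ((sing_val Phi (j+1))^2) \<cdot>\<^sub>v col U j)"

definition kmeans_cost :: "real mat \<Rightarrow> (nat \<Rightarrow> nat) \<Rightarrow> (nat \<Rightarrow> nat \<Rightarrow> real) \<Rightarrow> real" where
  "kmeans_cost U g c = (\<Sum>i<dim_row U. \<Sum>l<dim_col U. (U $$ (i,l) - c (g i) l)^2)"

definition is_assignment :: "nat \<Rightarrow> nat \<Rightarrow> (nat \<Rightarrow> nat) \<Rightarrow> bool" where
  "is_assignment s r g \<longleftrightarrow> (\<forall>i<s. g i < r)"

text \<open>(1+eps)-approximate k-means solution with r clusters on the rows of U
  (clusters: hat Omega_k = {i. g i = k}).\<close>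
definition kmeans_approx :: "real \<Rightarrow> nat \<Rightarrow> real mat \<Rightarrow> (nat \<Rightarrow> nat) \<Rightarrow> bool" where
  "kmeans_approx eps r U g \<longleftrightarrow> is_assignment (dim_row U) r g \<and>
     (\<exists>c. \<forall>h c'. is_assignment (dim_row U) r h \<longrightarrow>
        kmeans_cost U g c \<le> (1 + eps) * kmeans_cost U h c')"

definition misclust_rate :: "nat \<Rightarrow> (nat \<Rightarrow> nat set) \<Rightarrow> (nat \<Rightarrow> nat) \<Rightarrow> real" where
  "misclust_rate r Om g = Min ((\<lambda>h. \<Sum>k<r. real (card {i \<in> Om k. g i \<noteq> h k}) / real (card (Om k)))
       ` {h. bij_betw h {..<r} {..<r}})"

end

theory Submission
  imports Defs "Jordan_Normal_Form.Schur_Decomposition"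
begin

text \<open>
  Let \<open>P\<close> and \<open>Q\<close> be the orthogonal projections onto the column span of \<open>U\<close> and onto the
  vectors that are constant on each cluster, so that \<open>Phibar = Q Phi\<close>. The map
  \<open>x \<mapsto> U x\<close> is an isometry sending the rows of \<open>U\<close> to the rows of \<open>P\<close>, hence k-means on \<open>U\<close>
  can be compared with \<open>Q\<close> directly, without a rotation aligning two bases. Put
  \<open>\<tau> = r - <P, Q>\<close>: this is the k-means cost of the true clusters with their
  centroids, and \<open>2 \<tau>\<close> is the squared Frobenius norm of \<open>P - Q\<close>.

  By Ky Fan's maximum principle \<open>\<parallel>(1 - P) Phi\<parallel> \<le> \<parallel>(1 - Q) Phi\<parallel> = \<parallel>Phi - Phibar\<parallel>\<close> (Frobenius norms),
  so \<open>\<sigma>\<^sub>r(Phibar)\<^sup>2 \<tau> \<le> \<parallel>(1 - P) Phibar\<parallel>\<^sup>2 \<le> 4 \<parallel>Phi - Phibar\<parallel>\<^sup>2 \<le> 2 eAgg\<^sup>2\<close>. Rows of \<open>Q\<close> from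
  different clusters \<open>k\<close> and \<open>l\<close> are at squared distance \<open>1 / |k| + 1 / |l|\<close>. Markov's inequality
  bounds the number of rows whose k-means centre is far from the row of \<open>Q\<close>; the
  remaining rows exist in every cluster and are never merged, so by the pigeonhole
  principle they define the bijection.
\<close>

section \<open>Spectral theorem for real symmetric matrices\<close>

text \<open>For an eigenvector \<open>v\<close>, the form \<open>q\<close> equals
  \<open>a * w\<close> with \<open>w\<close> the squared norm of \<open>v\<close>. Symmetry of the
  real matrix makes \<open>q\<close> its own conjugate, and \<open>w\<close> is nonzero, so
  \<open>a\<close> has no imaginary part.\<close>

lemma symmetric_complex_eigenvalue_real:
  fixes M :: "real mat"
  assumes M: "M \<in> carrier_mat n n" and sym: "\<And>i j. i < n \<Longrightarrow> j < n \<Longrightarrow> M $$ (i,j) = M $$ (j,i)"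
    and ev: "eigenvalue (map_mat complex_of_real M) a"
  shows "Im a = 0"
proof -
  from ev obtain v where v: "v \<in> carrier_vec n" "v \<noteq> 0\<^sub>v n"
    and eq: "map_mat complex_of_real M *\<^sub>v v = a \<cdot>\<^sub>v v"
    using M unfolding eigenvalue_def eigenvector_def by auto
  have row: "(\<Sum>j<n. complex_of_real (M $$ (i,j)) * v $ j) = a * v $ i" if "i < n" for i
  proof -
    have "(map_mat complex_of_real M *\<^sub>v v) $ i = (a \<cdot>\<^sub>v v) $ i" using eq by simp
    then show ?thesis using that M v
      by (simp add: scalar_prod_def lessThan_atLeast0)
  qed
  define q where "q = (\<Sum>i<n. \<Sum>j<n. complex_of_real (M $$ (i,j)) * v $ j * cnj (v $ i))"
  define w where "w = (\<Sum>i<n. (cmod (v $ i))\<^sup>2)"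
  have q: "q = a * of_real w"
  proof -
    have "q = (\<Sum>i<n. (a * v $ i) * cnj (v $ i))"
      unfolding q_def by (intro sum.cong refl) (simp add: row[symmetric] sum_distrib_right)
    then show ?thesis by (simp add: w_def sum_distrib_left mult.assoc complex_norm_square del: of_real_power)
  qed
  have "cnj q = (\<Sum>i<n. \<Sum>j<n. complex_of_real (M $$ (i,j)) * cnj (v $ j) * v $ i)"
    by (simp add: q_def)
  also have "\<dots> = (\<Sum>j<n. \<Sum>i<n. complex_of_real (M $$ (i,j)) * cnj (v $ j) * v $ i)"
    by (rule sum.swap)
  also have "\<dots> = q" unfolding q_def
    by (intro sum.cong refl) (simp add: sym mult_ac)
  finally have "cnj q = q" .
  then have "Im q = 0" by (simp add: complex_eq_iff)
  then have "Im a * w = 0" by (simp add: q)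
  moreover have "w \<noteq> 0"
  proof
    assume "w = 0"
    then have "\<forall>i\<in>{..<n}. (cmod (v $ i))\<^sup>2 = 0"
      unfolding w_def by (subst (asm) sum_nonneg_eq_0_iff) auto
    then have "v = 0\<^sub>v n" using v by (intro eq_vecI) auto
    with v show False by simp
  qed
  ultimately show ?thesis by simp
qed

text \<open>The complex factorization has only real roots and therefore descends to the reals.
  Allowing any ordering \<open>es\<close> of the roots lets the sorted list behind
  \<open>sing_vals\<close> be used later.\<close>

lemma symmetric_char_poly_splits:
  fixes M :: "real mat"
  assumes M: "M \<in> carrier_mat n n" and sym: "\<And>i j. i < n \<Longrightarrow> j < n \<Longrightarrow> M $$ (i,j) = M $$ (j,i)"
    and es: "mset es = proots (char_poly M)"
  shows "char_poly M = (\<Prod>e\<leftarrow>es. [:- e, 1:])" "length es = n"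
proof -
  let ?M = "map_mat complex_of_real M"
  have cM: "?M \<in> carrier_mat n n" using M by simp
  obtain as where as: "char_poly ?M = (\<Prod>a\<leftarrow>as. [:- a, 1:])" and len: "length as = n"
    using char_poly_factorized[OF cM] by auto
  interpret h: map_poly_inj_idom_hom complex_of_real ..
  have real: "of_real (Re a) = a" if "a \<in> set as" for a
  proof -
    have "poly (char_poly ?M) a = 0" using that unfolding as
      by (induction as) auto
    then have "eigenvalue ?M a" by (simp add: eigenvalue_root_char_poly[OF cM])
    then show ?thesis using symmetric_complex_eigenvalue_real[OF M sym] by (simp add: complex_eq_iff)
  qed
  have "map_poly complex_of_real (char_poly M) = (\<Prod>a\<leftarrow>as. [:- a, 1:])"
    unfolding as[symmetric] by (rule of_real_hom.char_poly_hom[OF M, symmetric])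
  also have "\<dots> = (\<Prod>a\<leftarrow>as. map_poly complex_of_real [:- Re a, 1:])"
    using real by (intro arg_cong[of _ _ prod_list] map_cong refl) simp
  also have "\<dots> = map_poly complex_of_real (\<Prod>a\<leftarrow>as. [:- Re a, 1:])"
    by (simp add: h.hom_prod_list o_def)
  finally have cp: "char_poly M = (\<Prod>a\<leftarrow>as. [:- Re a, 1:])"
    by (simp add: h.eq_iff)
  have "proots (\<Prod>a\<leftarrow>xs. [:- Re a, 1:]) = mset (map Re xs)" for xs
  proof (induction xs)
    case (Cons a xs)
    have "(\<Prod>a\<leftarrow>xs. [:- Re a, 1:]) \<noteq> 0" by (simp add: prod_list_zero_iff image_iff)
    then show ?case using Cons by (simp add: proots_mult del: mult_pCons_left)
  qed simp
  then have ms: "mset es = mset (map Re as)" by (simp add: es cp)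
  show "length es = n" using arg_cong[OF ms, of size] len by simp
  have "(\<Prod>e\<leftarrow>es. [:- e, 1:]) = prod_mset (image_mset (\<lambda>e. [:- e, 1:]) (mset es))"
    by (metis mset_map prod_mset_prod_list)
  also have "\<dots> = (\<Prod>e\<leftarrow>map Re as. [:- e, 1:])" unfolding ms
    by (metis mset_map prod_mset_prod_list)
  finally show "char_poly M = (\<Prod>e\<leftarrow>es. [:- e, 1:])" by (simp add: cp o_def)
qed

text \<open>Gram-Schmidt on a basis that starts with \<open>v\<close> keeps \<open>v\<close> in
  first place; rescaling every column to unit length makes \<open>W\<close> orthogonal, with
  \<open>c\<close> the reciprocal of the norm of \<open>v\<close>.\<close>

lemma orthonormal_completion:
  fixes v :: "real vec"
  assumes v: "v \<in> carrier_vec n" "v \<noteq> 0\<^sub>v n"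
  obtains W c where "W \<in> carrier_mat n n" "W\<^sup>T * W = 1\<^sub>m n" "col W 0 = c \<cdot>\<^sub>v v"
proof -
  have n: "n \<noteq> 0" using v by auto
  interpret cof_vec_space n "TYPE(real)" .
  define b where "b = basis_completion v"
  define ws where "ws = gram_schmidt n b"
  from basis_completion[OF v, folded b_def]
  have dist_b: "distinct b" and indep: "\<not> lin_dep (set b)"
    and b: "set b \<subseteq> carrier_vec n" and hdb: "hd b = v" and len_b: "length b = n" by auto
  from hdb len_b n obtain vs where bv: "b = v # vs" by (cases b) auto
  from gram_schmidt_result[OF b dist_b indep refl, folded ws_def]
  have ws: "set ws \<subseteq> carrier_vec n" "corthogonal ws" "length ws = n"
    by (auto simp: len_b)
  from gram_schmidt_hd[OF v(1), of vs, folded bv] have hdws: "hd ws = v" unfolding ws_def .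
  have orth: "ws ! i \<bullet> ws ! j = 0 \<longleftrightarrow> i \<noteq> j" if "i < n" "j < n" for i j
    using corthogonalD[OF ws(2), of i j] that ws(3) by simp
  have wsn: "ws ! i \<in> carrier_vec n" if "i < n" for i using ws that by auto
  define N where "N i = 1 / sqrt (ws ! i \<bullet> ws ! i)" for i
  define W where "W = mat n n (\<lambda>(i,j). N j * (ws ! j) $ i)"
  have W: "W \<in> carrier_mat n n" by (simp add: W_def)
  have col: "col W j = N j \<cdot>\<^sub>v ws ! j" if "j < n" for j
    using that wsn[OF that] by (intro eq_vecI) (auto simp: W_def)
  have pos: "ws ! i \<bullet> ws ! i > 0" if "i < n" for i
    using orth[OF that that] by (simp add: scalar_prod_def order.strict_iff_order sum_nonneg)
  have "W\<^sup>T * W = 1\<^sub>m n"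
  proof (rule eq_matI)
    fix i j assume ij: "i < dim_row (1\<^sub>m n)" "j < dim_col (1\<^sub>m n)"
    then have ij': "i < n" "j < n" by auto
    have "(W\<^sup>T * W) $$ (i,j) = col W i \<bullet> col W j" using W ij' by simp
    also have "\<dots> = N i * N j * (ws ! i \<bullet> ws ! j)"
      using wsn[OF ij'(1)] wsn[OF ij'(2)] by (simp add: col ij')
    also have "\<dots> = (if i = j then 1 else 0)"
      using orth[OF ij'] pos[OF ij'(1)] by (auto simp: N_def field_simps)
    finally show "(W\<^sup>T * W) $$ (i,j) = 1\<^sub>m n $$ (i,j)" using ij' by simp
  qed (use W in auto)
  moreover have "col W 0 = N 0 \<cdot>\<^sub>v v"
    using col[of 0] n ws(3) hdws by (simp add: hd_conv_nth[of ws] flip: length_0_conv)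
  ultimately show thesis using that W by blast
qed

text \<open>Deflation: rotating an eigenvector for the head of \<open>es\<close> to the first basis
  vector splits off a one-by-one block, and induction treats the rest. The diagonal follows the
  prescribed order of \<open>es\<close>, which later ties column \<open>j\<close> to the
  \<open>j\<close>-th largest eigenvalue.\<close>

lemma symmetric_orthogonal_diagonalization:
  fixes M :: "real mat"
  assumes "M \<in> carrier_mat n n" and "M\<^sup>T = M"
    and "char_poly M = (\<Prod>e\<leftarrow>es. [:- e, 1:])" and "length es = n"
  shows "\<exists>V \<in> carrier_mat n n. V\<^sup>T * V = 1\<^sub>m n \<and> V\<^sup>T * M * V = mat_diag n (\<lambda>i. es ! i)"
  using assms
proof (induction es arbitrary: n M)
  case Nil
  then show ?case by (intro bexI[of _ "1\<^sub>m n"]) (auto simp: mat_eq_iff mat_diag_def)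
next
  case (Cons e es)
  note M = Cons.prems(1) and sym = Cons.prems(2)
  define m where "m = length es"
  have n: "n = Suc m" using Cons.prems(4) by (simp add: m_def)
  have cp: "char_poly M = [:- e, 1:] * (\<Prod>e\<leftarrow>es. [:- e, 1:])" using Cons.prems(3) by simp
  have "eigenvalue M e" unfolding eigenvalue_root_char_poly[OF M] cp by simp
  then obtain v where v: "v \<in> carrier_vec n" "v \<noteq> 0\<^sub>v n" and ev: "M *\<^sub>v v = e \<cdot>\<^sub>v v"
    using M unfolding eigenvalue_def eigenvector_def by auto
  obtain W c where W: "W \<in> carrier_mat n n" and WW: "W\<^sup>T * W = 1\<^sub>m n" and W0: "col W 0 = c \<cdot>\<^sub>v v"
    using orthonormal_completion[OF v] by metis
  have WT: "W\<^sup>T \<in> carrier_mat n n" using W by simp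
  have WW': "W * W\<^sup>T = 1\<^sub>m n" by (rule mat_mult_left_right_inverse[OF WT W WW])
  define M' where "M' = W\<^sup>T * M * W"
  have M': "M' \<in> carrier_mat n n" using W M by (simp add: M'_def)
  have sym': "M'\<^sup>T = M'"
  proof -
    have "M'\<^sup>T = W\<^sup>T * (W\<^sup>T * M)\<^sup>T" unfolding M'_def
      by (rule transpose_mult[of _ n n _ n]) (use W M in auto)
    also have "(W\<^sup>T * M)\<^sup>T = M\<^sup>T * W" using transpose_mult[OF WT M] by simp
    finally show ?thesis using W M by (simp add: M'_def sym assoc_mult_mat[OF WT M W])
  qed
  have symij: "M' $$ (i,j) = M' $$ (j,i)" if "i < n" "j < n" for i j
    using arg_cong[OF sym', of "\<lambda>X. X $$ (i,j)"] that M' by simp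
  have col0: "M' $$ (i,0) = (if i = 0 then e else 0)" if i: "i < n" for i
  proof -
    have "M' $$ (i,0) = (W\<^sup>T * (M * W)) $$ (i,0)" by (simp add: M'_def assoc_mult_mat[OF WT M W])
    also have "\<dots> = col W i \<bullet> col (M * W) 0" using i W M n by simp
    also have "col (M * W) 0 = M *\<^sub>v (c \<cdot>\<^sub>v v)" using W0 M W n by (metis col_mult2 zero_less_Suc)
    also have "\<dots> = e \<cdot>\<^sub>v col W 0" using ev M v W0 
      by (simp add: mult_mat_vec smult_smult_assoc mult.commute)
    also have "col W i \<bullet> (e \<cdot>\<^sub>v col W 0) = e * (W\<^sup>T * W) $$ (i,0)" using W i n by simp
    finally show ?thesis using i n by (simp add: WW)
  qed
  define A where "A = mat 1 1 (\<lambda>_. e)"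
  define M3 where "M3 = mat m m (\<lambda>(i,j). M' $$ (Suc i, Suc j))"
  have A: "A \<in> carrier_mat 1 1" and M3: "M3 \<in> carrier_mat m m" by (auto simp: A_def M3_def)
  \<comment> \<open>Below its corner the first column of \<open>M'\<close> vanishes, and by symmetry
    so does the first row to the right of it.\<close>
  have block: "M' = four_block_mat A (0\<^sub>m 1 m) (0\<^sub>m m 1) M3"
  proof (rule eq_matI)
    fix i j assume "i < dim_row (four_block_mat A (0\<^sub>m 1 m) (0\<^sub>m m 1) M3)"
      "j < dim_col (four_block_mat A (0\<^sub>m 1 m) (0\<^sub>m m 1) M3)"
    then have ij: "i < n" "j < n" using A M3 n by auto
    show "M' $$ (i,j) = four_block_mat A (0\<^sub>m 1 m) (0\<^sub>m m 1) M3 $$ (i,j)"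
      using ij A M3 n col0[OF ij(1)] col0[OF ij(2)] symij[OF ij]
      by (cases i; cases j) (auto simp: A_def M3_def)
  qed (use M' A M3 n in auto)
  have "similar_mat_wit M' M (W\<^sup>T) W"
    by (rule similar_mat_witI[of _ _ n]) (use W M M' WW WW' M'_def in auto)
  then have "char_poly M' = char_poly M" by (intro char_poly_similar) (auto simp: similar_mat_def)
  moreover have "char_poly M' = char_poly A * char_poly M3"
    unfolding block by (rule char_poly_four_block_zeros_col[OF A _ M3]) simp
  moreover have "char_poly A = [:- e, 1:]"
    by (simp add: A_def char_poly_defs det_def sign_def)
  \<comment> \<open>Similarity preserves the characteristic polynomial, so cancelling the factor of
    \<open>e\<close> leaves exactly the remaining eigenvalues for \<open>M3\<close>.\<close>
  ultimately have cp3: "char_poly M3 = (\<Prod>e\<leftarrow>es. [:- e, 1:])"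
    using cp by (metis mult_cancel_left pCons_eq_0_iff zero_neq_one)
  have sym3: "M3\<^sup>T = M3"
    by (rule eq_matI) (use n symij in \<open>auto simp: M3_def\<close>)
  obtain V where V: "V \<in> carrier_mat m m" and VV: "V\<^sup>T * V = 1\<^sub>m m"
    and VMV: "V\<^sup>T * M3 * V = mat_diag m (\<lambda>i. es ! i)"
    using Cons.IH[OF M3 sym3 cp3] m_def by blast
  define F where "F = four_block_mat (1\<^sub>m 1) (0\<^sub>m 1 m) (0\<^sub>m m 1) V"
  have F: "F \<in> carrier_mat n n" using V n by (auto simp: F_def)
  have FT: "F\<^sup>T = four_block_mat (1\<^sub>m 1) (0\<^sub>m 1 m) (0\<^sub>m m 1) (V\<^sup>T)" unfolding F_def
    by (subst transpose_four_block_mat[of _ 1 1 _ m _ m]) (use V in auto)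
  have FTc: "F\<^sup>T \<in> carrier_mat n n" using F by simp
  have FF: "F\<^sup>T * F = 1\<^sub>m n"
  proof -
    have "F\<^sup>T * F = four_block_mat (1\<^sub>m 1) (0\<^sub>m 1 m) (0\<^sub>m m 1) (V\<^sup>T * V)"
      unfolding FT unfolding F_def
      by (subst mult_four_block_mat[of _ 1 1 _ m _ m _ _ 1 _ m]) (use V in auto)
    then show ?thesis by (simp add: VV n)
  qed
  have FMF: "F\<^sup>T * M' * F = mat_diag n (\<lambda>i. (e # es) ! i)"
  proof -
    have "F\<^sup>T * M' = four_block_mat A (0\<^sub>m 1 m) (0\<^sub>m m 1) (V\<^sup>T * M3)"
      unfolding FT block
      by (subst mult_four_block_mat[of _ 1 1 _ m _ m _ _ 1 _ m]) (use V A M3 in auto)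
    moreover have "four_block_mat A (0\<^sub>m 1 m) (0\<^sub>m m 1) (V\<^sup>T * M3) * F
        = four_block_mat A (0\<^sub>m 1 m) (0\<^sub>m m 1) (V\<^sup>T * M3 * V)"
      unfolding F_def
      by (subst mult_four_block_mat[of _ 1 1 _ m _ m _ _ 1 _ m]) (use V A M3 in auto)
    moreover have "\<dots> = mat_diag n (\<lambda>i. (e # es) ! i)" unfolding VMV
      by (rule eq_matI) (auto simp: A_def mat_diag_def n nth_Cons')
    ultimately show ?thesis by simp
  qed
  show ?case
  proof (intro bexI[of _ "W * F"] conjI)
    have T: "(W * F)\<^sup>T = F\<^sup>T * W\<^sup>T" by (rule transpose_mult[OF W F])
    have "(W * F)\<^sup>T * (W * F) = F\<^sup>T * (W\<^sup>T * W) * F" unfolding T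
      using W F WT FTc by (simp add: assoc_mult_mat[of _ n n _ n _ n])
    then show "(W * F)\<^sup>T * (W * F) = 1\<^sub>m n" using FF FTc by (simp add: WW)
    have "(W * F)\<^sup>T * M * (W * F) = F\<^sup>T * M' * F" unfolding T M'_def
      using W F WT FTc M by (simp add: assoc_mult_mat[of _ n n _ n _ n])
    then show "(W * F)\<^sup>T * M * (W * F) = mat_diag n (\<lambda>i. (e # es) ! i)" by (simp add: FMF)
  qed (use W F in auto)
qed

section \<open>Orthonormal families and singular values\<close>

text \<open>Vectors of length \<open>s\<close> are functions on \<open>nat\<close> of which only the
  values below \<open>s\<close> count; sums can then be manipulated without carrier
  conditions.\<close>

definition ip :: "nat \<Rightarrow> (nat \<Rightarrow> real) \<Rightarrow> (nat \<Rightarrow> real) \<Rightarrow> real" where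
  "ip s x y = (\<Sum>i<s. x i * y i)"

definition orthonormal :: "nat \<Rightarrow> nat \<Rightarrow> (nat \<Rightarrow> nat \<Rightarrow> real) \<Rightarrow> bool" where
  "orthonormal s r b \<longleftrightarrow> (\<forall>k<r. \<forall>l<r. ip s (b k) (b l) = (if k = l then 1 else 0))"

definition proj :: "nat \<Rightarrow> nat \<Rightarrow> (nat \<Rightarrow> nat \<Rightarrow> real) \<Rightarrow> (nat \<Rightarrow> real) \<Rightarrow> nat \<Rightarrow> real" where
  "proj s r b x i = (\<Sum>k<r. ip s (b k) x * b k i)"

lemma ip_commute: "ip s x y = ip s y x"
  by (simp add: ip_def mult.commute)

lemma ip_self: "ip s x x = (\<Sum>i<s. (x i)\<^sup>2)"
  by (simp add: ip_def power2_eq_square)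

lemma ip_diff_right: "ip s x (\<lambda>i. y i - z i) = ip s x y - ip s x z"
  by (simp add: ip_def right_diff_distrib sum_subtractf)

lemma ip_cong: "(\<And>i. i < s \<Longrightarrow> x i = x' i) \<Longrightarrow> (\<And>i. i < s \<Longrightarrow> y i = y' i) \<Longrightarrow> ip s x y = ip s x' y'"
  by (simp add: ip_def)

lemma ip_sum_right: "ip s x (\<lambda>i. \<Sum>k\<in>A. a k * b k i) = (\<Sum>k\<in>A. a k * ip s x (b k))"
  unfolding ip_def by (simp add: sum_distrib_left mult_ac) (rule sum.swap)

lemma ip_sum_left: "ip s (\<lambda>i. \<Sum>k\<in>A. a k * b k i) x = (\<Sum>k\<in>A. a k * ip s (b k) x)"
  using ip_sum_right[of s x a b A] by (simp add: ip_commute)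

lemma ip_proj_right: "ip s x (proj s r b y) = (\<Sum>k<r. ip s (b k) x * ip s (b k) y)"
  unfolding proj_def ip_sum_right by (simp add: ip_commute mult.commute)

lemma orthonormal_coeff:
  assumes "orthonormal s r b" "l < r"
  shows "ip s (b l) (\<lambda>i. \<Sum>k<r. a k * b k i) = a l"
proof -
  have "(\<Sum>k<r. a k * ip s (b l) (b k)) = (\<Sum>k<r. if k = l then a k else 0)"
    using assms by (intro sum.cong refl) (auto simp: orthonormal_def)
  then show ?thesis using assms by (simp add: ip_sum_right)
qed

lemma orthonormal_norm:
  assumes "orthonormal s r b"
  shows "(\<Sum>i<s. (\<Sum>k<r. a k * b k i)\<^sup>2) = (\<Sum>k<r. (a k)\<^sup>2)"
proof -
  have "(\<Sum>i<s. (\<Sum>k<r. a k * b k i)\<^sup>2) = ip s (\<lambda>i. \<Sum>k<r. a k * b k i) (\<lambda>i. \<Sum>k<r. a k * b k i)"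
    by (simp add: ip_self)
  also have "\<dots> = (\<Sum>k<r. (a k)\<^sup>2)"
    by (subst ip_sum_left) (simp add: orthonormal_coeff[OF assms] power2_eq_square)
  finally show ?thesis .
qed

text \<open>Pythagoras: the inner product of \<open>x\<close> with its projection and the squared
  norm of the projection are both the sum of the squared coefficients.\<close>

lemma proj_residual:
  assumes "orthonormal s r b"
  shows "(\<Sum>i<s. (x i - proj s r b x i)\<^sup>2) = ip s x x - (\<Sum>k<r. (ip s (b k) x)\<^sup>2)"
proof -
  have "(\<Sum>i<s. (x i - proj s r b x i)\<^sup>2)
      = ip s x x - 2 * ip s x (proj s r b x) + (\<Sum>i<s. (proj s r b x i)\<^sup>2)"
    unfolding ip_def sum_distrib_left
    by (simp add: power2_diff sum.distrib sum_subtractf) (simp add: power2_eq_square mult_ac)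
  also have "(\<Sum>i<s. (proj s r b x i)\<^sup>2) = (\<Sum>k<r. (ip s (b k) x)\<^sup>2)"
    unfolding proj_def by (rule orthonormal_norm[OF assms])
  finally show ?thesis by (simp add: ip_proj_right power2_eq_square)
qed

lemma bessel:
  assumes "orthonormal s r b"
  shows "(\<Sum>k<r. (ip s (b k) x)\<^sup>2) \<le> ip s x x"
proof -
  have "0 \<le> (\<Sum>i<s. (x i - proj s r b x i)\<^sup>2)" by (intro sum_nonneg) simp
  then show ?thesis by (simp add: proj_residual[OF assms])
qed

lemma proj_residual_le:
  assumes "orthonormal s r b"
  shows "(\<Sum>i<s. (x i - proj s r b x i)\<^sup>2) \<le> ip s x x"
  unfolding proj_residual[OF assms] by (simp add: sum_nonneg)

text \<open>The left side is the Frobenius inner product of two projection kernels. The distance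
  formula below uses it for the cross term and for both squared norms.\<close>

lemma sum_kernel_inner:
  "(\<Sum>i<s. \<Sum>j<s. (\<Sum>l<r. u l i * u l j) * (\<Sum>k<q. b k i * b k j)) = (\<Sum>l<r. \<Sum>k<q. (ip s (u l) (b k))\<^sup>2)"
proof -
  have "(\<Sum>i<s. \<Sum>j<s. (\<Sum>l<r. u l i * u l j) * (\<Sum>k<q. b k i * b k j))
      = (\<Sum>i<s. \<Sum>j<s. \<Sum>l<r. \<Sum>k<q. (u l i * b k i) * (u l j * b k j))"
    by (simp add: sum_product mult_ac)
  also have "\<dots> = (\<Sum>i<s. \<Sum>l<r. \<Sum>j<s. \<Sum>k<q. (u l i * b k i) * (u l j * b k j))"
    by (intro sum.cong refl sum.swap)
  also have "\<dots> = (\<Sum>l<r. \<Sum>i<s. \<Sum>j<s. \<Sum>k<q. (u l i * b k i) * (u l j * b k j))"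
    by (rule sum.swap)
  also have "\<dots> = (\<Sum>l<r. \<Sum>i<s. \<Sum>k<q. \<Sum>j<s. (u l i * b k i) * (u l j * b k j))"
    by (intro sum.cong refl sum.swap)
  also have "\<dots> = (\<Sum>l<r. \<Sum>k<q. \<Sum>i<s. \<Sum>j<s. (u l i * b k i) * (u l j * b k j))"
    by (intro sum.cong refl sum.swap)
  finally show ?thesis by (simp add: ip_def sum_product power2_eq_square)
qed

text \<open>The kernels \<open>\<Sum>l<r. u l i * u l j\<close> are the entries of the orthogonal projection onto the span.\<close>

lemma kernel_distance:
  assumes u: "orthonormal s r u" and b: "orthonormal s r b"
  shows "(\<Sum>i<s. \<Sum>j<s. ((\<Sum>l<r. u l i * u l j) - (\<Sum>k<r. b k i * b k j))\<^sup>2)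
    = 2 * (real r - (\<Sum>l<r. \<Sum>k<r. (ip s (u l) (b k))\<^sup>2))"
proof -
  have self: "(\<Sum>l<r. \<Sum>k<r. (ip s (c l) (c k))\<^sup>2) = real r" if "orthonormal s r c" for c
  proof -
    have "(\<Sum>l<r. \<Sum>k<r. (ip s (c l) (c k))\<^sup>2) = (\<Sum>l<r. \<Sum>k<r. if k = l then 1 else 0)"
      using that by (intro sum.cong refl) (auto simp: orthonormal_def)
    then show ?thesis by simp
  qed
  show ?thesis
    using self[OF u] self[OF b] sum_kernel_inner[where u = u and b = u and r = r and q = r and s = s]
      sum_kernel_inner[where u = b and b = b and r = r and q = r and s = s]
      sum_kernel_inner[where u = u and b = b and r = r and q = r and s = s]
    by (simp add: power2_diff sum.distrib sum_subtractf sum_distrib_left[symmetric] mult.assoc)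
      (simp add: power2_eq_square)
qed

section \<open>Singular values through an orthonormal eigenbasis\<close>

text \<open>A total weight of \<open>r\<close>, at most one per item, is best spent on the
  \<open>r\<close> largest values. Subtracting the threshold \<open>t\<close> shifts both sides by
  \<open>t * r\<close> and makes the first \<open>r\<close> coefficients nonnegative and the others
  nonpositive, so each group can be compared termwise.\<close>

lemma weighted_sum_le_top:
  fixes lam w :: "nat \<Rightarrow> real"
  assumes "r \<le> s" and anti: "\<And>i j. i \<le> j \<Longrightarrow> j < s \<Longrightarrow> lam j \<le> lam i"
    and w: "\<And>j. j < s \<Longrightarrow> 0 \<le> w j \<and> w j \<le> 1" and tot: "(\<Sum>j<s. w j) = real r"
  shows "(\<Sum>j<s. lam j * w j) \<le> (\<Sum>j<r. lam j)"
proof (cases "r = 0")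
  case True
  then have "\<forall>j\<in>{..<s}. w j = 0" using tot w sum_nonneg_eq_0_iff[of "{..<s}" w] by simp
  then show ?thesis by (simp add: True)
next
  case False
  define t where "t = lam (r - 1)"
  have split: "(\<Sum>j<s. f j) = (\<Sum>j<r. f j) + (\<Sum>j=r..<s. f j)" for f :: "nat \<Rightarrow> real"
    using \<open>r \<le> s\<close> by (simp add: lessThan_atLeast0 sum.atLeastLessThan_concat)
  have "(\<Sum>j<s. (lam j - t) * w j) \<le> (\<Sum>j<r. lam j - t)"
  proof -
    have "(\<Sum>j<r. (lam j - t) * w j) \<le> (\<Sum>j<r. lam j - t)"
    proof (rule sum_mono)
      fix j assume "j \<in> {..<r}"
      then have "t \<le> lam j" "w j \<le> 1" using anti[of j "r - 1"] w[of j] False \<open>r \<le> s\<close> by (auto simp: t_def)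
      then show "(lam j - t) * w j \<le> lam j - t" using mult_left_le[of "w j" "lam j - t"] by simp
    qed
    moreover have "(\<Sum>j=r..<s. (lam j - t) * w j) \<le> 0"
    proof (rule sum_nonpos)
      fix j assume "j \<in> {r..<s}"
      then have "lam j \<le> t" "0 \<le> w j" using anti[of "r - 1" j] w[of j] False by (auto simp: t_def)
      then show "(lam j - t) * w j \<le> 0" by (simp add: mult_nonpos_nonneg)
    qed
    ultimately show ?thesis by (simp add: split)
  qed
  moreover have "(\<Sum>j<s. (lam j - t) * w j) = (\<Sum>j<s. lam j * w j) - t * real r"
    by (simp add: left_diff_distrib sum_subtractf tot flip: sum_distrib_left)
  ultimately show ?thesis by (simp add: sum_subtractf mult.commute)
qed

text \<open>A basis of the whole space, null directions included. The last clause says that it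
  diagonalizes \<open>X * X\<^sup>T\<close>, written through the columns of \<open>X\<close>;
  \<open>Suc\<close> appears because \<open>sing_val\<close> counts from one.\<close>

definition left_sing_basis :: "nat \<Rightarrow> nat \<Rightarrow> real mat \<Rightarrow> (nat \<Rightarrow> nat \<Rightarrow> real) \<Rightarrow> bool" where
  "left_sing_basis s d X v \<longleftrightarrow> orthonormal s s v \<and> (\<forall>y. \<forall>i<s. y i = (\<Sum>j<s. ip s (v j) y * v j i)) \<and>
      (\<forall>j<s. \<forall>j'<s. (\<Sum>m<d. ip s (v j) (\<lambda>i. X $$ (i,m)) * ip s (v j') (\<lambda>i. X $$ (i,m)))
         = (if j = j' then (sing_val X (Suc j))\<^sup>2 else 0))"

text \<open>The three facts share one diagonalization of \<open>X * X\<^sup>T\<close> along its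
  decreasingly sorted eigenvalues \<open>es\<close>, whose square roots are the singular
  values.\<close>

lemma
  assumes X: "X \<in> carrier_mat s d"
  shows left_sing_basis_exists: "\<exists>v. left_sing_basis s d X v"
    and sing_val_antimono: "i \<le> j \<Longrightarrow> j < s \<Longrightarrow> sing_val X (Suc j) \<le> sing_val X (Suc i)"
    and sing_val_nonneg: "j < s \<Longrightarrow> 0 \<le> sing_val X (Suc j)"
proof -
  define M where "M = X * X\<^sup>T"
  define es where "es = rev (sorted_list_of_multiset (proots (char_poly M)))"
  have M: "M \<in> carrier_mat s s" using X by (simp add: M_def)
  have MT: "M\<^sup>T = M" using X by (simp add: M_def transpose_mult[of _ s d _ s])
  have symij: "M $$ (i,j) = M $$ (j,i)" if "i < s" "j < s" for i j
    using arg_cong[OF MT, of "\<lambda>X. X $$ (i,j)"] that M by simp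
  have ms: "mset es = proots (char_poly M)" by (simp add: es_def)
  note split = symmetric_char_poly_splits[OF M symij ms]
  obtain V where V: "V \<in> carrier_mat s s" and VV: "V\<^sup>T * V = 1\<^sub>m s"
    and VMV: "V\<^sup>T * M * V = mat_diag s (\<lambda>i. es ! i)"
    using symmetric_orthogonal_diagonalization[OF M MT split] by blast
  have VT: "V\<^sup>T \<in> carrier_mat s s" using V by simp
  have VV': "V * V\<^sup>T = 1\<^sub>m s" by (rule mat_mult_left_right_inverse[OF VT V VV])
  define v where "v j i = V $$ (i,j)" for i j
  have sv: "sing_vals X = map sqrt es" by (simp add: sing_vals_def es_def M_def)
  have sval: "sing_val X (Suc j) = sqrt (es ! j)" if "j < s" for j
    using that by (simp add: sing_val_def sv split)
  have orth: "orthonormal s s v"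
    unfolding orthonormal_def
  proof (intro allI impI)
    fix k l assume kl: "k < s" "l < s"
    have "(V\<^sup>T * V) $$ (k,l) = (if k = l then 1 else 0)" using kl by (simp add: VV)
    then show "ip s (v k) (v l) = (if k = l then 1 else 0)" using kl V
      by (simp add: ip_def v_def scalar_prod_def lessThan_atLeast0)
  qed
  have compl: "y i = (\<Sum>j<s. ip s (v j) y * v j i)" if i: "i < s" for y i
  proof -
    have e: "(\<Sum>j<s. v j i' * v j i) = (if i = i' then 1 else 0)" if "i' < s" for i'
    proof -
      have "(V * V\<^sup>T) $$ (i',i) = (if i' = i then 1 else 0)" using i that by (simp add: VV')
      then show ?thesis using i that V
        by (auto simp add: ip_def v_def scalar_prod_def lessThan_atLeast0)
    qed
    have "(\<Sum>j<s. ip s (v j) y * v j i) = (\<Sum>j<s. \<Sum>i'<s. y i' * (v j i' * v j i))"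
      by (simp add: ip_def sum_distrib_left sum_distrib_right mult_ac)
    also have "\<dots> = (\<Sum>i'<s. \<Sum>j<s. y i' * (v j i' * v j i))" by (rule sum.swap)
    also have "\<dots> = (\<Sum>i'<s. if i' = i then y i' else 0)"
      by (intro sum.cong refl) (auto simp add: e simp flip: sum_distrib_left)
    also have "\<dots> = y i" using i by simp
    finally show ?thesis by simp
  qed
  have gram: "(\<Sum>m<d. ip s (v j) (\<lambda>i. X $$ (i,m)) * ip s (v j') (\<lambda>i. X $$ (i,m)))
         = (if j = j' then es ! j else 0)" if jj: "j < s" "j' < s" for j j'
  proof -
    have Y: "V\<^sup>T * X \<in> carrier_mat s d" using V X by simp
    have eq: "mat_diag s (\<lambda>i. es ! i) = (V\<^sup>T * X) * (V\<^sup>T * X)\<^sup>T"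
      unfolding VMV[symmetric]
      using X V by (simp add: M_def transpose_mult[of _ s s _ d] assoc_mult_mat[of _ s s _ d _ s]
          assoc_mult_mat[of _ s d _ s _ s] assoc_mult_mat[of _ s s _ s _ s])
    have "((V\<^sup>T * X) * (V\<^sup>T * X)\<^sup>T) $$ (j,j') = (if j = j' then es ! j else 0)"
      unfolding eq[symmetric] using jj by (simp add: mat_diag_def)
    moreover have "(Z * Z\<^sup>T) $$ (j,j') = (\<Sum>m<d. Z $$ (j,m) * Z $$ (j',m))" if "Z \<in> carrier_mat s d" for Z :: "real mat"
      using jj that by (simp add: scalar_prod_def lessThan_atLeast0)
    note this[OF Y]
    moreover have "(V\<^sup>T * X) $$ (j,m) = ip s (v j) (\<lambda>i. X $$ (i,m))" if "j < s" "m < d" for j m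
      using that V X by (simp add: ip_def v_def scalar_prod_def lessThan_atLeast0)
    ultimately show ?thesis using jj by simp
  qed
  \<comment> \<open>A diagonal Gram entry is a sum of squares. Nonnegativity is what makes the
    square of \<open>sing_val\<close> give back the eigenvalue.\<close>
  have nonneg: "0 \<le> es ! j" if "j < s" for j
  proof -
    have "0 \<le> (\<Sum>m<d. ip s (v j) (\<lambda>i. X $$ (i,m)) * ip s (v j) (\<lambda>i. X $$ (i,m)))"
      by (intro sum_nonneg) simp
    then show ?thesis by (simp add: gram that)
  qed
  show "j < s \<Longrightarrow> 0 \<le> sing_val X (Suc j)" by (simp add: sval nonneg)
  show "sing_val X (Suc j) \<le> sing_val X (Suc i)" if "i \<le> j" "j < s"
  proof -
    have "sorted_wrt (\<ge>) es" by (simp add: es_def sorted_wrt_rev)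
    then have "es ! j \<le> es ! i"
      using that split(2) by (cases "i = j") (auto simp: sorted_wrt_iff_nth_less)
    then show ?thesis using that by (simp add: sval)
  qed
  show "\<exists>v. left_sing_basis s d X v"
    unfolding left_sing_basis_def
    using orth compl gram nonneg by (intro exI[of _ v]) (auto simp: sval)
qed

section \<open>Subspace perturbation\<close>

context
  fixes s d X v and x :: "nat \<Rightarrow> nat \<Rightarrow> real"
  assumes basis: "left_sing_basis s d X v"
  defines "x \<equiv> \<lambda>m i. X $$ (i,m)"
begin

lemma left_sing_basis_orthonormal: "orthonormal s s v"
  using basis by (simp add: left_sing_basis_def)

lemma left_sing_basis_expand: "i < s \<Longrightarrow> y i = (\<Sum>j<s. ip s (v j) y * v j i)"
  using basis unfolding left_sing_basis_def by blast

lemma left_sing_basis_gram: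
  assumes "j < s" "j' < s"
  shows "(\<Sum>m<d. ip s (v j) (x m) * ip s (v j') (x m)) = (if j = j' then (sing_val X (Suc j))\<^sup>2 else 0)"
  using basis assms unfolding left_sing_basis_def x_def by blast

lemma left_sing_basis_parseval: "(\<Sum>j<s. (ip s (v j) y)\<^sup>2) = ip s y y"
  using orthonormal_norm[OF left_sing_basis_orthonormal, of "\<lambda>j. ip s (v j) y"]
  by (simp add: ip_self left_sing_basis_expand[of _ y, symmetric])

text \<open>Expanding \<open>y\<close> in the basis turns the quadratic form of
  \<open>X * X\<^sup>T\<close> into a double sum whose off-diagonal terms vanish.\<close>

lemma left_sing_basis_quadratic_form:
  "(\<Sum>m<d. (ip s y (x m))\<^sup>2) = (\<Sum>j<s. (sing_val X (Suc j))\<^sup>2 * (ip s (v j) y)\<^sup>2)"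
proof -
  have e: "ip s y (x m) = (\<Sum>j<s. ip s (v j) y * ip s (v j) (x m))" for m
  proof -
    have "ip s y (x m) = ip s (\<lambda>i. \<Sum>j<s. ip s (v j) y * v j i) (x m)"
      by (rule ip_cong) (simp_all add: left_sing_basis_expand[of _ y, symmetric])
    then show ?thesis by (simp add: ip_sum_left)
  qed
  have "(\<Sum>m<d. (ip s y (x m))\<^sup>2)
    = (\<Sum>m<d. \<Sum>j<s. \<Sum>j'<s. ip s (v j) y * ip s (v j') y * (ip s (v j) (x m) * ip s (v j') (x m)))"
    by (simp add: e power2_eq_square sum_product mult_ac)
  also have "\<dots> = (\<Sum>j<s. \<Sum>m<d. \<Sum>j'<s. ip s (v j) y * ip s (v j') y * (ip s (v j) (x m) * ip s (v j') (x m)))"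
    by (rule sum.swap)
  also have "\<dots> = (\<Sum>j<s. \<Sum>j'<s. \<Sum>m<d. ip s (v j) y * ip s (v j') y * (ip s (v j) (x m) * ip s (v j') (x m)))"
    by (intro sum.cong refl sum.swap)
  also have "\<dots> = (\<Sum>j<s. \<Sum>j'<s. if j' = j then (sing_val X (Suc j))\<^sup>2 * (ip s (v j) y)\<^sup>2 else 0)"
    by (intro sum.cong refl) (auto simp: left_sing_basis_gram power2_eq_square simp flip: sum_distrib_left)
  finally show ?thesis by simp
qed

text \<open>This is the eigenvector equation for \<open>X * X\<^sup>T\<close> in coordinate
  \<open>i\<close>, obtained by expanding each column of \<open>X\<close> in the basis.\<close>

lemma left_sing_basis_eigen:
  assumes "j < s" "i < s"
  shows "(\<Sum>m<d. ip s (v j) (x m) * x m i) = (sing_val X (Suc j))\<^sup>2 * v j i"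
proof -
  have "(\<Sum>m<d. ip s (v j) (x m) * x m i)
    = (\<Sum>m<d. \<Sum>j'<s. v j' i * (ip s (v j) (x m) * ip s (v j') (x m)))"
    by (intro sum.cong refl) (subst left_sing_basis_expand[OF assms(2), of "x _"], simp add: sum_distrib_left mult_ac)
  also have "\<dots> = (\<Sum>j'<s. \<Sum>m<d. v j' i * (ip s (v j) (x m) * ip s (v j') (x m)))"
    by (rule sum.swap)
  also have "\<dots> = (\<Sum>j'<s. if j' = j then (sing_val X (Suc j))\<^sup>2 * v j i else 0)"
    using assms by (intro sum.cong refl) (auto simp: left_sing_basis_gram simp flip: sum_distrib_left)
  finally show ?thesis using assms by simp
qed

lemma left_sing_basis_norm: "j < s \<Longrightarrow> (\<Sum>m<d. (ip s (v j) (x m))\<^sup>2) = (sing_val X (Suc j))\<^sup>2"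
  using left_sing_basis_gram[of j j] by (simp add: power2_eq_square)

end

text \<open>Ky Fan's maximum principle. In the eigenbasis the left side is a weighted sum of squared
  singular values; the weight \<open>w j\<close> is the squared length of the projection of
  \<open>v j\<close> onto the span of \<open>b\<close>. Bessel bounds it by one and Parseval gives
  total weight \<open>r\<close>.\<close>

lemma ky_fan:
  assumes X: "X \<in> carrier_mat s d" and "r \<le> s" and b: "orthonormal s r b"
  shows "(\<Sum>k<r. \<Sum>m<d. (ip s (b k) (\<lambda>i. X $$ (i,m)))\<^sup>2) \<le> (\<Sum>j<r. (sing_val X (Suc j))\<^sup>2)"
proof -
  obtain v where sb: "left_sing_basis s d X v" using left_sing_basis_exists[OF X] by blast
  note v = left_sing_basis_orthonormal[OF sb] and pars = left_sing_basis_parseval[OF sb]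
    and quad = left_sing_basis_quadratic_form[OF sb]
  define w where "w j = (\<Sum>k<r. (ip s (v j) (b k))\<^sup>2)" for j
  have "(\<Sum>k<r. \<Sum>m<d. (ip s (b k) (\<lambda>i. X $$ (i,m)))\<^sup>2) = (\<Sum>j<s. (sing_val X (Suc j))\<^sup>2 * w j)"
    unfolding quad w_def sum_distrib_left by (rule sum.swap)
  also have "\<dots> \<le> (\<Sum>j<r. (sing_val X (Suc j))\<^sup>2)"
  proof (rule weighted_sum_le_top[OF \<open>r \<le> s\<close>])
    show "(sing_val X (Suc j))\<^sup>2 \<le> (sing_val X (Suc i))\<^sup>2" if "i \<le> j" "j < s" for i j
      using sing_val_antimono[OF X] sing_val_nonneg[OF X] that by (intro power_mono) auto
    show "0 \<le> w j \<and> w j \<le> 1" if "j < s" for j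
      using bessel[OF b, of "v j"] v that by (simp add: w_def sum_nonneg ip_commute orthonormal_def)
    have "(\<Sum>j<s. w j) = (\<Sum>k<r. \<Sum>j<s. (ip s (v j) (b k))\<^sup>2)" unfolding w_def by (rule sum.swap)
    also have "\<dots> = real r" using b by (simp add: pars orthonormal_def)
    finally show "(\<Sum>j<s. w j) = real r" .
  qed
  finally show ?thesis .
qed

text \<open>The residual of \<open>Y\<close> off the span of \<open>u\<close> is estimated twice:
  from above by comparison with \<open>X\<close>, and from below by its expansion in the singular
  basis of \<open>Y\<close>, where the first \<open>r\<close> directions carry at least the factor
  \<open>(sing_val Y r)\<^sup>2\<close>.\<close>

lemma sin_theta_bound:
  assumes X: "X \<in> carrier_mat s d" and Y: "Y \<in> carrier_mat s d" and r: "0 < r" "r \<le> s"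
    and u: "orthonormal s r u" and b: "orthonormal s r b"
    and eig: "\<And>l. l < r \<Longrightarrow> (\<Sum>m<d. (ip s (u l) (\<lambda>i. X $$ (i,m)))\<^sup>2) = (sing_val X (Suc l))\<^sup>2"
    and XY: "\<And>i m. i < s \<Longrightarrow> m < d \<Longrightarrow> Y $$ (i,m) = proj s r b (\<lambda>i. X $$ (i,m)) i"
    and pos: "0 < sing_val Y r"
  shows "(sing_val Y r)\<^sup>2 * (real r - (\<Sum>l<r. \<Sum>k<r. (ip s (u l) (b k))\<^sup>2))
    \<le> 4 * (\<Sum>m<d. \<Sum>i<s. (X $$ (i,m) - Y $$ (i,m))\<^sup>2)"
proof -
  define x where "x = (\<lambda>m i. X $$ (i,m))"
  define y where "y = (\<lambda>m i. Y $$ (i,m))"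
  define \<delta> where "\<delta> = (\<Sum>m<d. \<Sum>i<s. (x m i - y m i)\<^sup>2)"
  have y: "y m i = proj s r b (x m) i" if "i < s" "m < d" for i m
    using XY[OF that] by (simp add: y_def x_def)
  let ?R = "\<lambda>z i. z i - proj s r u z i"
  \<comment> \<open>The top singular vectors \<open>u\<close> capture at least as much of
    \<open>X\<close> as \<open>b\<close> does, so their residual is no larger; the residual for
    \<open>b\<close> is \<open>\<delta>\<close>.\<close>
  have res_x: "(\<Sum>m<d. \<Sum>i<s. (?R (x m) i)\<^sup>2) \<le> \<delta>"
  proof -
    have "(\<Sum>m<d. \<Sum>k<r. (ip s (b k) (x m))\<^sup>2) = (\<Sum>k<r. \<Sum>m<d. (ip s (b k) (x m))\<^sup>2)"
      by (rule sum.swap)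
    also have "\<dots> \<le> (\<Sum>l<r. (sing_val X (Suc l))\<^sup>2)"
      using ky_fan[OF X r(2) b] by (simp add: x_def)
    also have "\<dots> = (\<Sum>l<r. \<Sum>m<d. (ip s (u l) (x m))\<^sup>2)"
      using eig by (simp add: x_def)
    also have "\<dots> = (\<Sum>m<d. \<Sum>l<r. (ip s (u l) (x m))\<^sup>2)" by (rule sum.swap)
    finally have "(\<Sum>m<d. \<Sum>k<r. (ip s (b k) (x m))\<^sup>2) \<le> (\<Sum>m<d. \<Sum>l<r. (ip s (u l) (x m))\<^sup>2)" .
    moreover have "\<delta> = (\<Sum>m<d. \<Sum>i<s. (x m i - proj s r b (x m) i)\<^sup>2)"
      unfolding \<delta>_def by (intro sum.cong refl) (simp add: y)
    ultimately show ?thesis by (simp add: proj_residual[OF u] proj_residual[OF b] sum_subtractf)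
  qed
  have res_y: "(\<Sum>m<d. \<Sum>i<s. (?R (y m) i)\<^sup>2) \<le> 4 * \<delta>"
  proof -
    have "(\<Sum>i<s. (?R (y m) i)\<^sup>2) \<le> 2 * (\<Sum>i<s. (?R (x m) i)\<^sup>2) + 2 * (\<Sum>i<s. (x m i - y m i)\<^sup>2)" for m
    proof -
      define z where "z i = x m i - y m i" for i
      \<comment> \<open>Taking residuals is linear and does not increase the norm, so replacing
        \<open>x\<close> by \<open>y\<close> costs at most the norm of their difference. The factor
        4 is 2 for each of the two terms.\<close>
      have "?R (y m) i = ?R (x m) i - ?R z i" for i
        by (simp add: proj_def z_def[abs_def] ip_diff_right left_diff_distrib sum_subtractf)
      moreover have "(a - c)\<^sup>2 \<le> 2 * a\<^sup>2 + 2 * c\<^sup>2" for a c :: real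
        using zero_le_power2[of "a + c"] by (simp add: power2_eq_square algebra_simps)
      ultimately have "(\<Sum>i<s. (?R (y m) i)\<^sup>2) \<le> (\<Sum>i<s. 2 * (?R (x m) i)\<^sup>2 + 2 * (?R z i)\<^sup>2)"
        by (intro sum_mono) metis
      also have "\<dots> = 2 * (\<Sum>i<s. (?R (x m) i)\<^sup>2) + 2 * (\<Sum>i<s. (?R z i)\<^sup>2)"
        by (simp add: sum.distrib sum_distrib_left)
      also have "(\<Sum>i<s. (?R z i)\<^sup>2) \<le> ip s z z" by (rule proj_residual_le[OF u])
      finally show ?thesis by (simp add: ip_self z_def)
    qed
    then have "(\<Sum>m<d. \<Sum>i<s. (?R (y m) i)\<^sup>2)
      \<le> (\<Sum>m<d. 2 * (\<Sum>i<s. (?R (x m) i)\<^sup>2) + 2 * (\<Sum>i<s. (x m i - y m i)\<^sup>2))"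
      by (rule sum_mono)
    also have "\<dots> = 2 * (\<Sum>m<d. \<Sum>i<s. (?R (x m) i)\<^sup>2) + 2 * \<delta>"
      by (simp add: sum.distrib sum_distrib_left \<delta>_def)
    finally show ?thesis using res_x by simp
  qed
  obtain v where sb: "left_sing_basis s d Y v" using left_sing_basis_exists[OF Y] by blast
  note v = left_sing_basis_orthonormal[OF sb] and pars = left_sing_basis_parseval[OF sb]
  have quad: "(\<Sum>m<d. (ip s z (y m))\<^sup>2) = (\<Sum>j<s. (sing_val Y (Suc j))\<^sup>2 * (ip s (v j) z)\<^sup>2)" for z
    using left_sing_basis_quadratic_form[OF sb] by (simp add: y_def)
  have veig: "(\<Sum>m<d. ip s (v j) (y m) * y m i) = (sing_val Y (Suc j))\<^sup>2 * v j i" if "j < s" "i < s" for j i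
    using left_sing_basis_eigen[OF sb that] by (simp add: y_def)
  have tr: "(\<Sum>m<d. (ip s (v j) (y m))\<^sup>2) = (sing_val Y (Suc j))\<^sup>2" if "j < s" for j
    using left_sing_basis_norm[OF sb that] by (simp add: y_def)
  \<comment> \<open>\<open>a j\<close> is the squared distance of \<open>v j\<close> from the span
    of \<open>u\<close>.\<close>
  define a where "a j = 1 - (\<Sum>l<r. (ip s (v j) (u l))\<^sup>2)" for j
  have a0: "0 \<le> a j" if "j < s" for j
    using bessel[OF u, of "v j"] v that by (simp add: a_def orthonormal_def ip_commute)
  have "(\<Sum>m<d. \<Sum>i<s. (?R (y m) i)\<^sup>2)
      = (\<Sum>m<d. \<Sum>j<s. (ip s (v j) (y m))\<^sup>2) - (\<Sum>m<d. \<Sum>l<r. (ip s (u l) (y m))\<^sup>2)"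
    by (simp add: proj_residual[OF u] sum_subtractf pars)
  also have "(\<Sum>m<d. \<Sum>j<s. (ip s (v j) (y m))\<^sup>2) = (\<Sum>j<s. \<Sum>m<d. (ip s (v j) (y m))\<^sup>2)"
    by (rule sum.swap)
  also have "\<dots> = (\<Sum>j<s. (sing_val Y (Suc j))\<^sup>2)" by (simp add: tr)
  also have "(\<Sum>m<d. \<Sum>l<r. (ip s (u l) (y m))\<^sup>2) = (\<Sum>l<r. \<Sum>m<d. (ip s (u l) (y m))\<^sup>2)"
    by (rule sum.swap)
  also have "\<dots> = (\<Sum>j<s. \<Sum>l<r. (sing_val Y (Suc j))\<^sup>2 * (ip s (v j) (u l))\<^sup>2)"
    unfolding quad by (rule sum.swap)
  also have "(\<Sum>j<s. (sing_val Y (Suc j))\<^sup>2) - \<dots> = (\<Sum>j<s. (sing_val Y (Suc j))\<^sup>2 * a j)"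
    by (simp add: a_def right_diff_distrib sum_subtractf sum_distrib_left)
  finally have res_a: "(\<Sum>m<d. \<Sum>i<s. (?R (y m) i)\<^sup>2) = (\<Sum>j<s. (sing_val Y (Suc j))\<^sup>2 * a j)" .
  have ge: "(sing_val Y r)\<^sup>2 \<le> (sing_val Y (Suc j))\<^sup>2" and pos': "0 < sing_val Y (Suc j)" if "j < r" for j
  proof -
    have "sing_val Y r \<le> sing_val Y (Suc j)"
      using sing_val_antimono[OF Y, of j "r - 1"] that r by simp
    then show "(sing_val Y r)\<^sup>2 \<le> (sing_val Y (Suc j))\<^sup>2" "0 < sing_val Y (Suc j)"
      using pos by (auto intro: power_mono)
  qed
  \<comment> \<open>A left singular vector of \<open>Y\<close> with nonzero singular value lies in the range of the projection.\<close>
  have range: "ip s (v j) z = ip s (v j) (proj s r b z)" if j: "j < r" for j z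
  proof -
    have e: "(sing_val Y (Suc j))\<^sup>2 * ip s (v j) w = (\<Sum>m<d. ip s (v j) (y m) * ip s (y m) w)" for w
    proof -
      have "(sing_val Y (Suc j))\<^sup>2 * ip s (v j) w = ip s (\<lambda>i. (sing_val Y (Suc j))\<^sup>2 * v j i) w"
        by (simp add: ip_def sum_distrib_left mult_ac)
      also have "\<dots> = ip s (\<lambda>i. \<Sum>m<d. ip s (v j) (y m) * y m i) w"
        by (rule ip_cong) (use veig j r in auto)
      finally show ?thesis by (simp add: ip_sum_left)
    qed
    \<comment> \<open>Each \<open>y m\<close> already lies in the span of \<open>b\<close>, so its
      inner product with \<open>z\<close> sees only the projection of \<open>z\<close>.\<close>
    have "ip s (y m) z = ip s (y m) (proj s r b z)" if m: "m < d" for m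
    proof -
      have 1: "ip s w (y m) = ip s w (proj s r b (x m))" for w
        by (rule ip_cong) (use y m in auto)
      have 2: "ip s (b k) (proj s r b (x m)) = ip s (b k) (x m)" if "k < r" for k
        unfolding proj_def[abs_def] by (rule orthonormal_coeff[OF b that])
      have "ip s (y m) z = (\<Sum>k<r. ip s (b k) z * ip s (b k) (x m))"
        by (subst ip_commute) (simp add: 1 ip_proj_right)
      moreover have "ip s (y m) (proj s r b z) = (\<Sum>k<r. ip s (b k) (y m) * ip s (b k) z)"
        by (rule ip_proj_right)
      ultimately show ?thesis by (simp add: 1 2 mult.commute)
    qed
    then have "(sing_val Y (Suc j))\<^sup>2 * ip s (v j) z = (sing_val Y (Suc j))\<^sup>2 * ip s (v j) (proj s r b z)"
      by (simp add: e)
    then show ?thesis using pos'[OF j] by simp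
  qed
  have ov: "orthonormal s r v" using v r by (auto simp: orthonormal_def)
  \<comment> \<open>The first \<open>r\<close> vectors of \<open>v\<close> see only the projection
    of \<open>u l\<close> onto the span of \<open>b\<close>; Bessel for these vectors then gives the
    bound.\<close>
  have le: "(\<Sum>j<r. (ip s (v j) (u l))\<^sup>2) \<le> (\<Sum>k<r. (ip s (u l) (b k))\<^sup>2)" for l
  proof -
    have "(\<Sum>j<r. (ip s (v j) (u l))\<^sup>2) = (\<Sum>j<r. (ip s (v j) (proj s r b (u l)))\<^sup>2)"
      by (intro sum.cong refl) (simp flip: range)
    also have "\<dots> \<le> ip s (proj s r b (u l)) (proj s r b (u l))" by (rule bessel[OF ov])
    also have "\<dots> = (\<Sum>k<r. (ip s (u l) (b k))\<^sup>2)"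
      using orthonormal_norm[OF b, of "\<lambda>k. ip s (b k) (u l)"] by (simp add: ip_self proj_def ip_commute)
    finally show ?thesis .
  qed
  have "real r - (\<Sum>l<r. \<Sum>k<r. (ip s (u l) (b k))\<^sup>2) \<le> real r - (\<Sum>l<r. \<Sum>j<r. (ip s (v j) (u l))\<^sup>2)"
    using sum_mono[of "{..<r}", OF le] by simp
  also have "\<dots> = (\<Sum>j<r. a j)"
    unfolding a_def sum_subtractf by (subst sum.swap) simp
  finally have "(sing_val Y r)\<^sup>2 * (real r - (\<Sum>l<r. \<Sum>k<r. (ip s (u l) (b k))\<^sup>2))
      \<le> (sing_val Y r)\<^sup>2 * (\<Sum>j<r. a j)"
    by (intro mult_left_mono) auto
  also have "\<dots> = (\<Sum>j<r. (sing_val Y r)\<^sup>2 * a j)" by (rule sum_distrib_left)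
  also have "\<dots> \<le> (\<Sum>j<r. (sing_val Y (Suc j))\<^sup>2 * a j)"
    by (intro sum_mono mult_right_mono) (use ge a0 r in auto)
  also have "\<dots> \<le> (\<Sum>j<s. (sing_val Y (Suc j))\<^sup>2 * a j)"
    by (intro sum_mono2) (use r a0 in auto)
  finally show ?thesis using res_a res_y by (simp add: \<delta>_def x_def y_def)
qed

section \<open>Rank and positivity of singular values\<close>

lemma rank_sum_of_products_le:
  fixes f g :: "nat \<Rightarrow> nat \<Rightarrow> real"
  shows "vec_space.rank s (mat s d (\<lambda>(i,m). \<Sum>j<k. f j i * g j m)) \<le> k"
proof (induction k)
  case 0
  have zero: "mat s d (\<lambda>(i,m). \<Sum>j<(0::nat). f j i * g j m) = 0\<^sub>m s d" by (intro eq_matI) auto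
  show ?case unfolding zero vec_space.rank_0I by simp
next
  case (Suc k)
  let ?A = "mat s d (\<lambda>(i,m). \<Sum>j<k. f j i * g j m)" and ?B = "mat s d (\<lambda>(i,m). f k i * g k m)"
  have "mat s d (\<lambda>(i,m). \<Sum>j<Suc k. f j i * g j m) = ?A + ?B" by (intro eq_matI) auto
  moreover have "vec_space.rank s (?A + ?B) \<le> vec_space.rank s ?A + vec_space.rank s ?B"
    by (rule vec_space.rank_subadditive) auto
  moreover have "vec_space.rank s ?B \<le> 1"
    by (rule vec_space.rank_le_1_product_entries[where f = "f k" and g = "g k"]) auto
  ultimately show ?case using Suc by simp
qed

text \<open>If the \<open>r\<close>-th singular value vanished, so would all later ones, and every
  column would be a combination of the first \<open>r - 1\<close> singular vectors, forcing a
  smaller rank.\<close>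

lemma sing_val_rank_pos:
  assumes X: "X \<in> carrier_mat s d" and r: "0 < r" "r \<le> s" and rank: "mat_rank X = r"
  shows "0 < sing_val X r"
proof (rule ccontr)
  assume "\<not> 0 < sing_val X r"
  then have "sing_val X (Suc j) = 0" if "r - 1 \<le> j" "j < s" for j
    using sing_val_antimono[OF X that] sing_val_nonneg[OF X that(2)] r by simp
  moreover obtain v where sb: "left_sing_basis s d X v" using left_sing_basis_exists[OF X] by blast
  note ex = left_sing_basis_expand[OF sb] and tr = left_sing_basis_norm[OF sb]
  ultimately have zero: "ip s (v j) (\<lambda>i. X $$ (i,m)) = 0" if "r - 1 \<le> j" "j < s" "m < d" for j m
    using that tr[of j] sum_nonneg_eq_0_iff[of "{..<d}" "\<lambda>m. (ip s (v j) (\<lambda>i. X $$ (i,m)))\<^sup>2"] by simp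
  have "X = mat s d (\<lambda>(i,m). \<Sum>j<r-1. v j i * ip s (v j) (\<lambda>i. X $$ (i,m)))"
  proof (rule eq_matI)
    fix i m assume "i < dim_row (mat s d (\<lambda>(i,m). \<Sum>j<r-1. v j i * ip s (v j) (\<lambda>i. X $$ (i,m))))"
      "m < dim_col (mat s d (\<lambda>(i,m). \<Sum>j<r-1. v j i * ip s (v j) (\<lambda>i. X $$ (i,m))))"
    then have im: "i < s" "m < d" by auto
    have "X $$ (i,m) = (\<Sum>j<s. ip s (v j) (\<lambda>i. X $$ (i,m)) * v j i)"
      by (rule ex[OF im(1), of "\<lambda>i. X $$ (i,m)"])
    also have "\<dots> = (\<Sum>j<r-1. ip s (v j) (\<lambda>i. X $$ (i,m)) * v j i)"
      by (rule sum.mono_neutral_right) (use r zero im in auto)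
    finally show "X $$ (i,m) = mat s d (\<lambda>(i,m). \<Sum>j<r-1. v j i * ip s (v j) (\<lambda>i. X $$ (i,m))) $$ (i,m)"
      using im by (simp add: mult.commute)
  qed (use X in auto)
  then have "vec_space.rank s X \<le> r - 1"
    using rank_sum_of_products_le[of s d v "\<lambda>j m. ip s (v j) (\<lambda>i. X $$ (i,m))" "r - 1"] by simp
  then show False using rank X r by (simp add: mat_rank_def)
qed

section \<open>Cluster averages and misclustering\<close>

lemma sum_squares_le_square_sum:
  fixes f :: "'a \<Rightarrow> real"
  assumes "\<And>i. i \<in> A \<Longrightarrow> 0 \<le> f i"
  shows "(\<Sum>i\<in>A. (f i)\<^sup>2) \<le> (\<Sum>i\<in>A. f i)\<^sup>2"
  using assms
proof (induction A rule: infinite_finite_induct)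
  case (insert a A)
  have "0 \<le> f a * sum f A" using insert.prems by (intro mult_nonneg_nonneg sum_nonneg) auto
  then show ?case using insert by (simp add: power2_sum)
qed auto

text \<open>The hypotheses on the modes bound sums of unsquared distances, whereas Frobenius
  estimates need squares. The passage costs no constant: it is applied once per level of
  summation.\<close>

lemma triple_sum_squares_le:
  fixes f :: "nat \<Rightarrow> 'a \<Rightarrow> 'b \<Rightarrow> real"
  assumes "\<And>k i i'. 0 \<le> f k i i'" and "(\<Sum>k<r. \<Sum>i\<in>S k. \<Sum>i'\<in>S' k. f k i i') \<le> e"
  shows "(\<Sum>k<r. \<Sum>i\<in>S k. \<Sum>i'\<in>S' k. (f k i i')\<^sup>2) \<le> e\<^sup>2"
proof -
  have "(\<Sum>k<r. \<Sum>i\<in>S k. \<Sum>i'\<in>S' k. (f k i i')\<^sup>2) \<le> (\<Sum>k<r. \<Sum>i\<in>S k. (\<Sum>i'\<in>S' k. f k i i')\<^sup>2)"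
    by (intro sum_mono sum_squares_le_square_sum assms)
  also have "\<dots> \<le> (\<Sum>k<r. (\<Sum>i\<in>S k. \<Sum>i'\<in>S' k. f k i i')\<^sup>2)"
    by (intro sum_mono sum_squares_le_square_sum sum_nonneg assms)
  also have "\<dots> \<le> (\<Sum>k<r. \<Sum>i\<in>S k. \<Sum>i'\<in>S' k. f k i i')\<^sup>2"
    by (intro sum_squares_le_square_sum sum_nonneg assms)
  also have "\<dots> \<le> e\<^sup>2"
    using assms by (intro power_mono sum_nonneg) auto
  finally show ?thesis .
qed

lemma sum_lessThan_add:
  fixes f :: "nat \<Rightarrow> real"
  shows "(\<Sum>m<a+b. f m) = (\<Sum>m<a. f m) + (\<Sum>m<b. f (a + m))"
  by (induction b) auto

text \<open>The index \<open>m\<close> walks through an \<open>n\<close> by \<open>q\<close> matrix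
  column by column, matching the vectorization in \<open>feature_mat\<close>.\<close>

lemma sum_mod_div:
  fixes f :: "nat \<Rightarrow> nat \<Rightarrow> real"
  shows "(\<Sum>m<n*q. f (m mod n) (m div n)) = (\<Sum>i<n. \<Sum>j<q. f i j)"
proof (induction q)
  case (Suc q)
  have "n * Suc q = n * q + n" by simp
  then have "(\<Sum>m<n * Suc q. f (m mod n) (m div n))
      = (\<Sum>m<n*q. f (m mod n) (m div n)) + (\<Sum>m<n. f ((n*q + m) mod n) ((n*q + m) div n))"
    by (simp only: sum_lessThan_add)
  also have "(\<Sum>m<n. f ((n*q + m) mod n) ((n*q + m) div n)) = (\<Sum>m<n. f m q)"
    by (intro sum.cong refl) auto
  finally show ?case using Suc by (simp add: sum.distrib)
qed simp

section \<open>Distances between rows of the feature matrix\<close>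

lemma fro_norm_nonneg: "0 \<le> fro_norm M"
  by (simp add: fro_norm_def sum_nonneg)

text \<open>The index range splits into three blocks. Those of \<open>A\<close> and \<open>B\<close>
  give equalities; only the block of \<open>T\<close> loses, by passing from the Euclidean to the l1
  distance.\<close>

lemma feature_mat_row_distance:
  fixes aA aB aT :: real
  assumes "\<forall>i<s. A i \<in> carrier_mat n n \<and> B i \<in> carrier_mat n p" and "T \<in> carrier_mat s s"
    and "i < s" "i' < s"
  defines "Phi \<equiv> feature_mat s n p aA aB aT A B T"
  shows "(\<Sum>m<n*n+n*p+s. (Phi $$ (i,m) - Phi $$ (i',m))\<^sup>2)
    \<le> aA\<^sup>2 * (fro_norm (A i - A i'))\<^sup>2 + aB\<^sup>2 * (fro_norm (B i - B i'))\<^sup>2 + aT\<^sup>2 * (row_l1_dist T i i')\<^sup>2"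
proof -
  let ?d = "\<lambda>m. (Phi $$ (i,m) - Phi $$ (i',m))\<^sup>2"
  have A: "A i \<in> carrier_mat n n" "A i' \<in> carrier_mat n n" and B: "B i \<in> carrier_mat n p" "B i' \<in> carrier_mat n p"
    using assms by auto
  have fro: "(fro_norm M)\<^sup>2 = (\<Sum>i<dim_row M. \<Sum>j<dim_col M. (M $$ (i,j))\<^sup>2)" for M
    by (simp add: fro_norm_def sum_nonneg)
  have "(\<Sum>m<n*n. ?d m) = (\<Sum>m<n*n. aA\<^sup>2 * (A i $$ (m mod n, m div n) - A i' $$ (m mod n, m div n))\<^sup>2)"
    using assms(3,4) unfolding Phi_def feature_mat_def
    by (intro sum.cong refl) (simp flip: right_diff_distrib power_mult_distrib)
  also have "\<dots> = aA\<^sup>2 * (fro_norm (A i - A i'))\<^sup>2"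
    using A unfolding sum_distrib_left[symmetric] fro
    by (subst sum_mod_div[of "\<lambda>a b. (A i $$ (a,b) - A i' $$ (a,b))\<^sup>2"]) simp
  finally have 1: "(\<Sum>m<n*n. ?d m) = aA\<^sup>2 * (fro_norm (A i - A i'))\<^sup>2" .
  have "(\<Sum>m<n*p. ?d (n*n+m)) = (\<Sum>m<n*p. aB\<^sup>2 * (B i $$ (m mod n, m div n) - B i' $$ (m mod n, m div n))\<^sup>2)"
    using assms(3,4) unfolding Phi_def feature_mat_def
    by (intro sum.cong refl) (simp flip: right_diff_distrib power_mult_distrib)
  also have "\<dots> = aB\<^sup>2 * (fro_norm (B i - B i'))\<^sup>2"
    using B unfolding sum_distrib_left[symmetric] fro
    by (subst sum_mod_div[of "\<lambda>a b. (B i $$ (a,b) - B i' $$ (a,b))\<^sup>2"]) simp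
  finally have 2: "(\<Sum>m<n*p. ?d (n*n+m)) = aB\<^sup>2 * (fro_norm (B i - B i'))\<^sup>2" .
  have "(\<Sum>m<s. ?d (n*n+n*p+m)) = (\<Sum>m<s. aT\<^sup>2 * \<bar>T $$ (i,m) - T $$ (i',m)\<bar>\<^sup>2)"
    using assms(3,4) unfolding Phi_def feature_mat_def
    by (intro sum.cong refl) (simp flip: right_diff_distrib power_mult_distrib)
  also have "\<dots> \<le> aT\<^sup>2 * (row_l1_dist T i i')\<^sup>2"
    unfolding sum_distrib_left[symmetric] row_l1_dist_def
    using assms(2) sum_squares_le_square_sum[of "{..<s}" "\<lambda>j. \<bar>T $$ (i,j) - T $$ (i',j)\<bar>"]
    by (intro mult_left_mono) auto
  finally have 3: "(\<Sum>m<s. ?d (n*n+n*p+m)) \<le> aT\<^sup>2 * (row_l1_dist T i i')\<^sup>2" .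
  show ?thesis using 1 2 3 by (simp add: sum_lessThan_add)
qed

text \<open>The sum over ordered pairs is exactly \<open>2 * c\<close> times the squared deviation
  from the mean, with \<open>c\<close> the size of \<open>K\<close>; the factor \<open>c\<close> is
  then dropped since it is at least one.\<close>

lemma sum_square_dev_mean:
  fixes x :: "'a \<Rightarrow> real"
  assumes "finite K" "K \<noteq> {}"
  shows "(\<Sum>i\<in>K. (x i - (\<Sum>i\<in>K. x i) / real (card K))\<^sup>2) \<le> (\<Sum>i\<in>K. \<Sum>i'\<in>K. (x i - x i')\<^sup>2) / 2"
proof -
  define c where "c = real (card K)"
  have c: "1 \<le> c" using assms by (simp add: c_def Suc_le_eq card_gt_0_iff)
  define Q where "Q = (\<Sum>i\<in>K. (x i)\<^sup>2)"
  define L where "L = (\<Sum>i\<in>K. x i)"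
  have dev: "(\<Sum>i\<in>K. (x i - L / c)\<^sup>2) = Q - L\<^sup>2 / c"
  proof -
    have "(\<Sum>i\<in>K. (x i - L / c)\<^sup>2) = Q - 2 * L * (L / c) + c * (L / c)\<^sup>2"
      by (simp add: power2_diff sum.distrib sum_subtractf Q_def L_def c_def
          sum_distrib_right[symmetric] sum_distrib_left[symmetric] del: sum_divide_distrib times_divide_eq_right)
    then show ?thesis using c by (simp add: field_simps power2_eq_square)
  qed
  have pairs: "(\<Sum>i\<in>K. \<Sum>i'\<in>K. (x i - x i')\<^sup>2) = 2 * (c * Q - L\<^sup>2)"
    by (simp add: power2_diff sum.distrib sum_subtractf Q_def L_def c_def sum_distrib_left[symmetric] mult.assoc)
      (simp add: power2_eq_square sum_distrib_right[symmetric])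
  have "0 \<le> Q - L\<^sup>2 / c" unfolding dev[symmetric] by (intro sum_nonneg) simp
  then have "1 * (Q - L\<^sup>2 / c) \<le> c * (Q - L\<^sup>2 / c)" using c by (intro mult_right_mono)
  also have "\<dots> = c * Q - L\<^sup>2" using c by (simp add: right_diff_distrib)
  finally have le: "Q - L\<^sup>2 / c \<le> c * Q - L\<^sup>2" by simp
  have half: "(\<Sum>i\<in>K. \<Sum>i'\<in>K. (x i - x i')\<^sup>2) / 2 = c * Q - L\<^sup>2" unfolding pairs by simp
  show ?thesis unfolding L_def[symmetric] c_def[symmetric] dev half by (rule le)
qed

section \<open>Partitions and normalized cluster indicators\<close>

lemma clus_of_eq:
  assumes "is_partition s r Om" "k < r" "i \<in> Om k"
  shows "clus_of r Om i = k"
  unfolding clus_of_def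
  by (rule the_equality) (use assms in \<open>auto simp: is_partition_def\<close>)

lemma partition_finite: "is_partition s r Om \<Longrightarrow> k < r \<Longrightarrow> finite (Om k)"
  unfolding is_partition_def by (metis UN_upper finite_lessThan finite_subset lessThan_iff)

lemma partition_card_pos: "is_partition s r Om \<Longrightarrow> k < r \<Longrightarrow> 0 < card (Om k)"
  using partition_finite[of s r Om k] by (simp add: is_partition_def card_gt_0_iff)

lemma partition_less: "is_partition s r Om \<Longrightarrow> k < r \<Longrightarrow> i \<in> Om k \<Longrightarrow> i < s"
  unfolding is_partition_def by blast

lemma clus_of_mem:
  assumes "is_partition s r Om" "i < s"
  shows "clus_of r Om i < r" "i \<in> Om (clus_of r Om i)"
proof -
  obtain k where "k < r" "i \<in> Om k" using assms unfolding is_partition_def by blast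
  then show "clus_of r Om i < r" "i \<in> Om (clus_of r Om i)" using clus_of_eq[OF assms(1)] by auto
qed

lemma sum_partition:
  fixes f :: "nat \<Rightarrow> real"
  assumes "is_partition s r Om"
  shows "(\<Sum>i<s. f i) = (\<Sum>k<r. \<Sum>i\<in>Om k. f i)"
proof -
  have "(\<Sum>i<s. f i) = sum f (\<Union>k<r. Om k)" using assms by (simp add: is_partition_def)
  also have "\<dots> = (\<Sum>k<r. \<Sum>i\<in>Om k. f i)"
    using assms partition_finite[OF assms]
    by (intro sum.UNION_disjoint) (auto simp: is_partition_def)
  finally show ?thesis .
qed

lemma partition_le:
  assumes "is_partition s r Om"
  shows "r \<le> s"
proof -
  have "real r = (\<Sum>k<r. 1)" by simp
  also have "\<dots> \<le> (\<Sum>k<r. \<Sum>i\<in>Om k. 1)"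
    using partition_card_pos[OF assms] by (intro sum_mono) (simp add: Suc_le_eq)
  also have "\<dots> = real s" unfolding sum_partition[OF assms, symmetric] by simp
  finally show ?thesis by simp
qed

text \<open>For a partition these normalized indicators form an orthonormal basis of the vectors
  that are constant on each cluster.\<close>

definition cluster_vec :: "(nat \<Rightarrow> nat set) \<Rightarrow> nat \<Rightarrow> nat \<Rightarrow> real" where
  "cluster_vec Om k i = (if i \<in> Om k then 1 / sqrt (real (card (Om k))) else 0)"

lemma ip_cluster_vec:
  assumes "is_partition s r Om" "k < r"
  shows "ip s (cluster_vec Om k) x = (\<Sum>i\<in>Om k. x i) / sqrt (real (card (Om k)))"
proof -
  have "ip s (cluster_vec Om k) x = (\<Sum>i\<in>Om k. cluster_vec Om k i * x i)"
    unfolding ip_def using partition_less[OF assms]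
    by (intro sum.mono_neutral_right) (auto simp: cluster_vec_def)
  then show ?thesis by (simp add: cluster_vec_def sum_divide_distrib)
qed

lemma orthonormal_cluster_vec:
  assumes "is_partition s r Om"
  shows "orthonormal s r (cluster_vec Om)"
  unfolding orthonormal_def
proof (intro allI impI)
  fix k l assume kl: "k < r" "l < r"
  show "ip s (cluster_vec Om k) (cluster_vec Om l) = (if k = l then 1 else 0)"
  proof (cases "k = l")
    case True
    then show ?thesis using partition_card_pos[OF assms kl(1)]
      by (simp add: ip_cluster_vec[OF assms kl(2)] cluster_vec_def real_div_sqrt)
  next
    case False
    then have "(\<Sum>i\<in>Om k. cluster_vec Om l i) = 0"
      using assms kl by (intro sum.neutral) (auto simp: cluster_vec_def is_partition_def)
    then show ?thesis using False by (simp add: ip_cluster_vec[OF assms kl(1)])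
  qed
qed

text \<open>Exactly one cluster contains \<open>i\<close>, so one term survives. This evaluates the
  averaged matrix, the projection kernel and the centroid cost.\<close>

lemma cluster_vec_combination:
  assumes "is_partition s r Om" "i < s"
  shows "(\<Sum>k<r. a k * cluster_vec Om k i) = a (clus_of r Om i) / sqrt (real (card (Om (clus_of r Om i))))"
proof -
  have "(\<Sum>k<r. a k * cluster_vec Om k i)
    = (\<Sum>k<r. if k = clus_of r Om i then a k / sqrt (real (card (Om k))) else 0)"
  proof (intro sum.cong refl)
    fix k assume "k \<in> {..<r}"
    then have "i \<in> Om k \<longleftrightarrow> k = clus_of r Om i"
      using clus_of_mem(2)[OF assms] clus_of_eq[OF assms(1), of k i] by blast
    then show "a k * cluster_vec Om k i = (if k = clus_of r Om i then a k / sqrt (real (card (Om k))) else 0)"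
      by (simp add: cluster_vec_def)
  qed
  then show ?thesis using clus_of_mem[OF assms] by simp
qed

text \<open>One square root comes from the coefficient and one from the basis vector; together they
  divide by the cluster size.\<close>

lemma averaged_mat_eq_proj:
  assumes "is_partition s r Om" "X \<in> carrier_mat s d" "i < s" "m < d"
  shows "averaged_mat r Om X $$ (i,m) = proj s r (cluster_vec Om) (\<lambda>i. X $$ (i,m)) i"
proof -
  let ?K = "Om (clus_of r Om i)"
  have "proj s r (cluster_vec Om) (\<lambda>i. X $$ (i,m)) i
      = (\<Sum>i\<in>?K. X $$ (i,m)) / sqrt (real (card ?K)) / sqrt (real (card ?K))"
    unfolding proj_def cluster_vec_combination[OF assms(1,3)]
    using clus_of_mem[OF assms(1,3)] by (simp add: ip_cluster_vec[OF assms(1)])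
  also have "\<dots> = averaged_mat r Om X $$ (i,m)" using assms by (simp add: averaged_mat_def)
  finally show ?thesis by simp
qed

lemma cluster_kernel:
  assumes "is_partition s r Om" "i < s" "j < s"
  defines "K \<equiv> Om (clus_of r Om i)"
  shows "(\<Sum>k<r. cluster_vec Om k i * cluster_vec Om k j) = (if j \<in> K then 1 / real (card K) else 0)"
proof -
  have "(\<Sum>k<r. cluster_vec Om k i * cluster_vec Om k j) = (\<Sum>k<r. cluster_vec Om k j * cluster_vec Om k i)"
    by (simp add: mult.commute)
  also have "\<dots> = cluster_vec Om (clus_of r Om i) j / sqrt (real (card K))"
    using cluster_vec_combination[OF assms(1,2), of "\<lambda>k. cluster_vec Om k j"] by (simp add: K_def)
  finally show ?thesis by (simp add: cluster_vec_def K_def)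
qed

text \<open>In each column and cluster the deviation from the mean is at most half the sum over
  pairs, whence the factor 2. Exchanging the sums leaves squared row distances, which the three
  aggregation bounds control.\<close>

lemma feature_deviation_bound:
  fixes A B :: "nat \<Rightarrow> real mat" and T :: "real mat" and aA aB aT :: real
  assumes AB: "\<forall>i<s. A i \<in> carrier_mat n n \<and> B i \<in> carrier_mat n p" and T: "T \<in> carrier_mat s s"
    and part: "is_partition s r Om"
    and eA: "(\<Sum>k<r. \<Sum>i\<in>Om k. \<Sum>i'\<in>Om k. fro_norm (A i - A i')) \<le> eA"
    and eB: "(\<Sum>k<r. \<Sum>i\<in>Om k. \<Sum>i'\<in>Om k. fro_norm (B i - B i')) \<le> eB"
    and eT: "(\<Sum>k<r. \<Sum>i\<in>Om k. \<Sum>i'\<in>Om k. row_l1_dist T i i') \<le> eT"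
  defines "Phi \<equiv> feature_mat s n p aA aB aT A B T"
  shows "2 * (\<Sum>m<n*n+n*p+s. \<Sum>i<s. (Phi $$ (i,m) - averaged_mat r Om Phi $$ (i,m))\<^sup>2)
    \<le> aA\<^sup>2 * eA\<^sup>2 + aB\<^sup>2 * eB\<^sup>2 + aT\<^sup>2 * eT\<^sup>2"
proof -
  let ?d = "n*n+n*p+s"
  have Phi: "Phi \<in> carrier_mat s ?d" by (simp add: Phi_def feature_mat_def)
  have avg: "averaged_mat r Om Phi $$ (i,m) = (\<Sum>i'\<in>Om k. Phi $$ (i',m)) / real (card (Om k))"
    if "k < r" "i \<in> Om k" "m < ?d" for k i m
    using Phi that partition_less[OF part that(1,2)] by (simp add: averaged_mat_def clus_of_eq[OF part that(1,2)])
  have "2 * (\<Sum>m<?d. \<Sum>i<s. (Phi $$ (i,m) - averaged_mat r Om Phi $$ (i,m))\<^sup>2)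
    = (\<Sum>m<?d. \<Sum>k<r. 2 * (\<Sum>i\<in>Om k. (Phi $$ (i,m) - (\<Sum>i'\<in>Om k. Phi $$ (i',m)) / real (card (Om k)))\<^sup>2))"
    unfolding sum_partition[OF part] sum_distrib_left by (intro sum.cong refl) (simp add: avg)
  also have "\<dots> \<le> (\<Sum>m<?d. \<Sum>k<r. \<Sum>i\<in>Om k. \<Sum>i'\<in>Om k. (Phi $$ (i,m) - Phi $$ (i',m))\<^sup>2)"
  proof (intro sum_mono)
    fix m k assume "k \<in> {..<r}"
    then have "finite (Om k)" "Om k \<noteq> {}" using part partition_finite[OF part] by (auto simp: is_partition_def)
    from sum_square_dev_mean[OF this, of "\<lambda>i. Phi $$ (i,m)"]
    show "2 * (\<Sum>i\<in>Om k. (Phi $$ (i,m) - (\<Sum>i'\<in>Om k. Phi $$ (i',m)) / real (card (Om k)))\<^sup>2)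
      \<le> (\<Sum>i\<in>Om k. \<Sum>i'\<in>Om k. (Phi $$ (i,m) - Phi $$ (i',m))\<^sup>2)" by simp
  qed
  also have "\<dots> = (\<Sum>k<r. \<Sum>m<?d. \<Sum>i\<in>Om k. \<Sum>i'\<in>Om k. (Phi $$ (i,m) - Phi $$ (i',m))\<^sup>2)"
    by (rule sum.swap)
  also have "\<dots> = (\<Sum>k<r. \<Sum>i\<in>Om k. \<Sum>m<?d. \<Sum>i'\<in>Om k. (Phi $$ (i,m) - Phi $$ (i',m))\<^sup>2)"
    by (intro sum.cong refl sum.swap)
  also have "\<dots> = (\<Sum>k<r. \<Sum>i\<in>Om k. \<Sum>i'\<in>Om k. \<Sum>m<?d. (Phi $$ (i,m) - Phi $$ (i',m))\<^sup>2)"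
    by (intro sum.cong refl sum.swap)
  also have "\<dots> \<le> (\<Sum>k<r. \<Sum>i\<in>Om k. \<Sum>i'\<in>Om k. aA\<^sup>2 * (fro_norm (A i - A i'))\<^sup>2
      + aB\<^sup>2 * (fro_norm (B i - B i'))\<^sup>2 + aT\<^sup>2 * (row_l1_dist T i i')\<^sup>2)"
    unfolding Phi_def
    by (intro sum_mono feature_mat_row_distance[OF AB T]) (use partition_less[OF part] in auto)
  also have "\<dots> = aA\<^sup>2 * (\<Sum>k<r. \<Sum>i\<in>Om k. \<Sum>i'\<in>Om k. (fro_norm (A i - A i'))\<^sup>2)
      + aB\<^sup>2 * (\<Sum>k<r. \<Sum>i\<in>Om k. \<Sum>i'\<in>Om k. (fro_norm (B i - B i'))\<^sup>2)
      + aT\<^sup>2 * (\<Sum>k<r. \<Sum>i\<in>Om k. \<Sum>i'\<in>Om k. (row_l1_dist T i i')\<^sup>2)"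
    by (simp add: sum.distrib sum_distrib_left)
  also have "\<dots> \<le> aA\<^sup>2 * eA\<^sup>2 + aB\<^sup>2 * eB\<^sup>2 + aT\<^sup>2 * eT\<^sup>2"
    by (intro add_mono mult_left_mono triple_sum_squares_le eA eB eT)
      (auto simp: fro_norm_nonneg row_l1_dist_def sum_nonneg)
  finally show ?thesis .
qed

section \<open>From row errors to the misclustering rate\<close>

text \<open>Bijections are functions on all of \<open>nat\<close>, with arbitrary values from
  \<open>r\<close> on, so \<open>Min\<close> is meaningful only because the set of rates is finite:
  each rate depends on the restriction of \<open>h\<close>. The given \<open>h\<close> also shows
  that this set is nonempty.\<close>

lemma misclust_rate_le:
  assumes "bij_betw h {..<r} {..<r}"
  shows "misclust_rate r Om g \<le> (\<Sum>k<r. real (card {i \<in> Om k. g i \<noteq> h k}) / real (card (Om k)))"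
    and "0 \<le> misclust_rate r Om g"
proof -
  let ?F = "\<lambda>h. \<Sum>k<r. real (card {i \<in> Om k. g i \<noteq> h k}) / real (card (Om k))"
  let ?H = "{h. bij_betw h {..<r} {..<r}}"
  have "?F ` ?H \<subseteq> ?F ` ({..<r} \<rightarrow>\<^sub>E {..<r})"
  proof (rule image_subsetI)
    fix h :: "nat \<Rightarrow> nat" assume "h \<in> ?H"
    then have "restrict h {..<r} \<in> {..<r} \<rightarrow>\<^sub>E {..<r}" by (auto simp: bij_betw_def)
    moreover have "?F h = ?F (restrict h {..<r})" by (intro sum.cong refl) simp
    ultimately show "?F h \<in> ?F ` ({..<r} \<rightarrow>\<^sub>E {..<r})" by blast
  qed
  then have fin: "finite (?F ` ?H)" by (rule finite_subset) (intro finite_imageI finite_PiE; simp)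
  show "misclust_rate r Om g \<le> ?F h"
    unfolding misclust_rate_def by (rule Min_le[OF fin]) (use assms in auto)
  have "Min (?F ` ?H) \<in> ?F ` ?H" by (rule Min_in[OF fin]) (use assms in auto)
  then show "0 \<le> misclust_rate r Om g" unfolding misclust_rate_def by (auto intro!: sum_nonneg)
qed

text \<open>\<open>Z\<close> holds the estimated centres and \<open>q\<close> the true ones.
  Markov's inequality limits the badly approximated rows, and the good rows of distinct clusters
  never share a label.\<close>

lemma misclust_rate_from_row_errors:
  fixes Z :: "nat \<Rightarrow> nat \<Rightarrow> real"
  assumes part: "is_partition s r Om" and r: "0 < r" and g: "\<forall>i<s. g i < r"
  defines "q \<equiv> \<lambda>k j. if j \<in> Om k then 1 / real (card (Om k)) else 0"
  defines "Omax \<equiv> real (Max (card ` Om ` {..<r}))"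
  defines "Omin \<equiv> real (Min (card ` Om ` {..<r}))"
  assumes D: "(\<Sum>i<s. \<Sum>j<s. (Z (g i) j - q (clus_of r Om i) j)\<^sup>2) \<le> D"
    and small: "4 * D < 1 + Omin / Omax"
  shows "misclust_rate r Om g \<le> 4 * D" and "4 * D < 1 / Omax \<Longrightarrow> misclust_rate r Om g = 0"
proof -
  define c where "c k = real (card (Om k))" for k
  have c: "1 \<le> c k" "c k \<le> Omax" "Omin \<le> c k" if "k < r" for k
    using partition_card_pos[OF part that] that
    by (auto simp: c_def Omax_def Omin_def Suc_le_eq image_image)
  have Omax: "0 < Omax" using c[OF r] by simp
  define e where "e i = (\<Sum>j<s. (Z (g i) j - q (clus_of r Om i) j)\<^sup>2)" for i
  \<comment> \<open>The threshold depends on the cluster: its part \<open>1 / c k\<close> weights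
    bad rows as the rate does, while \<open>1 / Omax\<close> supplies the extra
    \<open>Omin / Omax\<close> in the smallness condition.\<close>
  define S where "S k = {i \<in> Om k. 1 / c k + 1 / Omax \<le> 4 * e i}" for k
  have e0: "0 \<le> e i" for i by (simp add: e_def sum_nonneg)
  have finS: "finite (S k)" if "k < r" for k
    using partition_finite[OF part that] by (simp add: S_def)
  have markov: "(\<Sum>k<r. real (card (S k)) * (1 / c k + 1 / Omax)) \<le> 4 * D"
  proof -
    have "(\<Sum>k<r. real (card (S k)) * (1 / c k + 1 / Omax)) \<le> (\<Sum>k<r. \<Sum>i\<in>Om k. 4 * e i)"
    proof (rule sum_mono)
      fix k assume k: "k \<in> {..<r}"
      have "real (card (S k)) * (1 / c k + 1 / Omax) = (\<Sum>i\<in>S k. 1 / c k + 1 / Omax)" by simp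
      also have "\<dots> \<le> (\<Sum>i\<in>S k. 4 * e i)" by (intro sum_mono) (simp add: S_def)
      also have "\<dots> \<le> (\<Sum>i\<in>Om k. 4 * e i)"
        using partition_finite[OF part] k e0 by (intro sum_mono2) (auto simp: S_def)
      finally show "real (card (S k)) * (1 / c k + 1 / Omax) \<le> (\<Sum>i\<in>Om k. 4 * e i)" .
    qed
    also have "\<dots> = 4 * (\<Sum>i<s. e i)" by (simp add: sum_partition[OF part] sum_distrib_left)
    finally show ?thesis using D by (simp add: e_def)
  qed
  have term_nonneg: "0 \<le> real (card (S k)) * (1 / c k + 1 / Omax)" if "k < r" for k
    using c[OF that] Omax by simp
  have term_le: "real (card (S k)) * (1 / c k + 1 / Omax) \<le> 4 * D" if "k < r" for k
  proof -
    have "real (card (S k)) * (1 / c k + 1 / Omax) \<le> (\<Sum>k<r. real (card (S k)) * (1 / c k + 1 / Omax))"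
      by (rule member_le_sum[where f = "\<lambda>k. real (card (S k)) * (1 / c k + 1 / Omax)"])
        (use that term_nonneg in auto)
    then show ?thesis using markov by linarith
  qed
  \<comment> \<open>An entirely bad cluster would contribute \<open>1 + c k / Omax\<close> to the
    Markov bound, too much by \<open>small\<close>.\<close>
  have "\<exists>i. i \<in> Om k - S k" if k: "k < r" for k
  proof (rule ccontr)
    assume "\<not> ?thesis"
    then have "S k = Om k" by (auto simp: S_def)
    then have "c k * (1 / c k + 1 / Omax) \<le> 4 * D" using term_le[OF k] by (simp add: c_def)
    moreover have "c k * (1 / c k + 1 / Omax) = 1 + c k / Omax" using c[OF k] by (simp add: distrib_left)
    moreover have "Omin / Omax \<le> c k / Omax" using c[OF k] Omax by (simp add: divide_right_mono)
    ultimately show False using small by linarith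
  qed
  then obtain t where t: "\<And>k. k < r \<Longrightarrow> t k \<in> Om k - S k" by metis
  have sep: "k = l" if kl: "k < r" "l < r" and i: "i \<in> Om k - S k" "i' \<in> Om l - S l" and eq: "g i = g i'"
    for k l i i'
  proof (rule ccontr)
    assume ne: "k \<noteq> l"
    have disj: "Om k \<inter> Om l = {}" using part kl ne by (auto simp: is_partition_def)
    have sub: "Om k \<subseteq> {..<s}" "Om l \<subseteq> {..<s}" using partition_less[OF part] kl by auto
    \<comment> \<open>The two true centres have disjoint supports, so their squared norms
      add.\<close>
    have "(\<Sum>j<s. (q k j - q l j)\<^sup>2) = (\<Sum>j<s. (if j \<in> Om k then 1 / (c k)\<^sup>2 else 0) + (if j \<in> Om l then 1 / (c l)\<^sup>2 else 0))"
      using disj by (intro sum.cong refl) (auto simp: q_def c_def power_divide)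
    also have "\<dots> = (\<Sum>j\<in>Om k. 1 / (c k)\<^sup>2) + (\<Sum>j\<in>Om l. 1 / (c l)\<^sup>2)"
      using sub by (simp add: sum.distrib sum.If_cases Int_absorb1)
    also have "\<dots> = 1 / c k + 1 / c l"
      using c[OF kl(1)] c[OF kl(2)] by (simp add: power2_eq_square c_def[symmetric])
    finally have dist: "(\<Sum>j<s. (q k j - q l j)\<^sup>2) = 1 / c k + 1 / c l" .
    have "(\<Sum>j<s. (q k j - q l j)\<^sup>2) \<le> (\<Sum>j<s. 2 * (Z (g i) j - q k j)\<^sup>2 + 2 * (Z (g i') j - q l j)\<^sup>2)"
    proof (rule sum_mono)
      fix j
      have "(a - b)\<^sup>2 \<le> 2 * (z - a)\<^sup>2 + 2 * (z - b)\<^sup>2" for a b z :: real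
        using zero_le_power2[of "2 * z - a - b"] by (simp add: power2_eq_square algebra_simps)
      then show "(q k j - q l j)\<^sup>2 \<le> 2 * (Z (g i) j - q k j)\<^sup>2 + 2 * (Z (g i') j - q l j)\<^sup>2"
        unfolding eq .
    qed
    also have "\<dots> = 2 * e i + 2 * e i'"
      using clus_of_eq[OF part kl(1), of i] clus_of_eq[OF part kl(2), of i'] i
      by (simp add: sum.distrib sum_distrib_left e_def)
    finally have "1 / c k + 1 / c l \<le> 2 * e i + 2 * e i'" unfolding dist .
    moreover have "4 * e i < 1 / c k + 1 / Omax" "4 * e i' < 1 / c l + 1 / Omax"
      using i by (auto simp: S_def)
    moreover have "1 / Omax \<le> 1 / c k" "1 / Omax \<le> 1 / c l"
      using c[OF kl(1)] c[OF kl(2)] by (auto intro!: divide_left_mono)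
    ultimately show False by linarith
  qed
  \<comment> \<open>Each cluster takes the label of one of its good rows. Separation makes this
    injective, hence bijective on a finite set.\<close>
  define h where "h k = g (t k)" for k
  have inj: "inj_on h {..<r}"
  proof (rule inj_onI)
    fix k l assume "k \<in> {..<r}" "l \<in> {..<r}" "h k = h l"
    then show "k = l" using sep[OF _ _ t t] by (simp add: h_def)
  qed
  have "h ` {..<r} \<subseteq> {..<r}"
    using t g partition_less[OF part] by (auto simp: h_def)
  then have surj: "h ` {..<r} = {..<r}" using endo_inj_surj[OF _ _ inj] by simp
  then have bij: "bij_betw h {..<r} {..<r}" using inj by (simp add: bij_betw_def)
  \<comment> \<open>The label of a good row of cluster \<open>k\<close> is \<open>h l\<close> for
    some \<open>l\<close>, by surjectivity; separation forces \<open>l = k\<close>. So only bad rows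
    can be misclustered.\<close>
  have bad: "{i \<in> Om k. g i \<noteq> h k} \<subseteq> S k" if k: "k < r" for k
  proof (rule subsetI, rule ccontr)
    fix i assume i: "i \<in> {i \<in> Om k. g i \<noteq> h k}" "i \<notin> S k"
    then have "g i \<in> h ` {..<r}" using g partition_less[OF part k] by (simp add: surj)
    then obtain l where "l < r" "g i = g (t l)" by (auto simp: h_def)
    then have "k = l" using sep[OF k \<open>l < r\<close> _ t[OF \<open>l < r\<close>]] i by auto
    then show False using i \<open>g i = g (t l)\<close> by (simp add: h_def)
  qed
  have "misclust_rate r Om g \<le> (\<Sum>k<r. real (card {i \<in> Om k. g i \<noteq> h k}) / real (card (Om k)))"
    by (rule misclust_rate_le(1)[OF bij])
  also have "\<dots> \<le> (\<Sum>k<r. real (card (S k)) / c k)"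
    unfolding c_def using bad finS by (intro sum_mono divide_right_mono) (auto intro: card_mono)
  finally have rate: "misclust_rate r Om g \<le> (\<Sum>k<r. real (card (S k)) / c k)" .
  also have "\<dots> \<le> (\<Sum>k<r. real (card (S k)) * (1 / c k + 1 / Omax))"
    using Omax by (intro sum_mono) (simp add: distrib_left)
  finally show "misclust_rate r Om g \<le> 4 * D" using markov by linarith
  show "misclust_rate r Om g = 0" if small': "4 * D < 1 / Omax"
  proof -
    \<comment> \<open>Bad rows come in whole numbers: a single one would already contribute at least
      \<open>1 / Omax\<close>.\<close>
    have "card (S k) = 0" if k: "k < r" for k
    proof (rule ccontr)
      assume "card (S k) \<noteq> 0"
      then have "1 * (1 / c k + 1 / Omax) \<le> real (card (S k)) * (1 / c k + 1 / Omax)"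
        using c[OF k] Omax by (intro mult_right_mono) auto
      from order_trans[OF this term_le[OF k]] have "1 / c k + 1 / Omax \<le> 4 * D" by simp
      moreover have "0 \<le> 1 / c k" using c[OF k] by simp
      ultimately show False using small' by linarith
    qed
    then have "misclust_rate r Om g \<le> 0" using rate by simp
    then show ?thesis using misclust_rate_le(2)[OF bij, of Om g] by simp
  qed
qed

section \<open>Approximate k-means\<close>

text \<open>The constant is \<open>2 * (1 + eps)\<close> from the k-means cost plus
  \<open>2 * 2\<close> from the squared distance \<open>2 * \<tau>\<close> between the two
  projections.\<close>

lemma kmeans_row_errors:
  assumes part: "is_partition s r Om" and U: "U \<in> carrier_mat s r"
  defines "u \<equiv> \<lambda>l i. U $$ (i,l)"
  assumes u: "orthonormal s r u" and g: "kmeans_approx eps r U g" and eps: "0 \<le> eps"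
  defines "q \<equiv> \<lambda>k j. if j \<in> Om k then 1 / real (card (Om k)) else 0"
  defines "\<tau> \<equiv> real r - (\<Sum>l<r. \<Sum>k<r. (ip s (u l) (cluster_vec Om k))\<^sup>2)"
  obtains Z where "(\<Sum>i<s. \<Sum>j<s. (Z (g i) j - q (clus_of r Om i) j)\<^sup>2) \<le> (6 + 2 * eps) * \<tau>"
proof -
  let ?b = "cluster_vec Om"
  note b = orthonormal_cluster_vec[OF part]
  obtain c where c: "\<And>h c'. is_assignment s r h \<Longrightarrow> kmeans_cost U g c \<le> (1 + eps) * kmeans_cost U h c'"
    using g U unfolding kmeans_approx_def by auto
  \<comment> \<open>\<open>c' k\<close> is the mean of the rows of \<open>U\<close> over the true
    cluster \<open>k\<close>, so the cost of the true clustering is the residual of the columns of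
    \<open>U\<close>.\<close>
  define c' where "c' k l = ip s (?b k) (u l) / sqrt (real (card (Om k)))" for k l
  have "kmeans_cost U (clus_of r Om) c' = (\<Sum>i<s. \<Sum>l<r. (u l i - proj s r ?b (u l) i)\<^sup>2)"
    using U unfolding kmeans_cost_def
    by (intro sum.cong refl) (auto simp: c'_def u_def proj_def cluster_vec_combination[OF part])
  also have "\<dots> = (\<Sum>l<r. \<Sum>i<s. (u l i - proj s r ?b (u l) i)\<^sup>2)" by (rule sum.swap)
  also have "\<dots> = \<tau>"
    using u by (simp add: proj_residual[OF b] sum_subtractf \<tau>_def orthonormal_def ip_commute)
  finally have "kmeans_cost U g c \<le> (1 + eps) * \<tau>"
    using c[of "clus_of r Om" c'] clus_of_mem(1)[OF part] by (simp add: is_assignment_def)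
  \<comment> \<open>\<open>Z k\<close> is \<open>U\<close> applied to the centre \<open>c k\<close>.
    The columns of \<open>U\<close> are orthonormal, so distances are preserved, and row
    \<open>i\<close> of \<open>U\<close> goes to row \<open>i\<close> of \<open>P\<close>.\<close>
  define Z where "Z k j = (\<Sum>l<r. c k l * u l j)" for k j
  define P where "P i j = (\<Sum>l<r. u l i * u l j)" for i j
  define Q where "Q i j = (\<Sum>k<r. ?b k i * ?b k j)" for i j
  have "(\<Sum>i<s. \<Sum>j<s. (Z (g i) j - P i j)\<^sup>2) = kmeans_cost U g c"
  proof -
    have "(\<Sum>j<s. (Z (g i) j - P i j)\<^sup>2) = (\<Sum>l<r. (U $$ (i,l) - c (g i) l)\<^sup>2)" for i
    proof -
      have "(\<Sum>j<s. (Z (g i) j - P i j)\<^sup>2) = (\<Sum>j<s. (\<Sum>l<r. (c (g i) l - u l i) * u l j)\<^sup>2)"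
        by (simp add: Z_def P_def left_diff_distrib sum_subtractf)
      also have "\<dots> = (\<Sum>l<r. (c (g i) l - u l i)\<^sup>2)" by (rule orthonormal_norm[OF u])
      finally show ?thesis by (simp add: u_def power2_commute)
    qed
    then show ?thesis using U by (simp add: kmeans_cost_def)
  qed
  with \<open>kmeans_cost U g c \<le> (1 + eps) * \<tau>\<close>
  have ZP: "(\<Sum>i<s. \<Sum>j<s. (Z (g i) j - P i j)\<^sup>2) \<le> (1 + eps) * \<tau>" by simp
  have PQ: "(\<Sum>i<s. \<Sum>j<s. (P i j - Q i j)\<^sup>2) = 2 * \<tau>"
    unfolding P_def Q_def \<tau>_def by (rule kernel_distance[OF u b])
  have "(\<Sum>i<s. \<Sum>j<s. (Z (g i) j - q (clus_of r Om i) j)\<^sup>2) = (\<Sum>i<s. \<Sum>j<s. (Z (g i) j - Q i j)\<^sup>2)"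
    unfolding Q_def by (intro sum.cong refl) (simp add: cluster_kernel[OF part] q_def)
  also have "\<dots> \<le> (\<Sum>i<s. \<Sum>j<s. 2 * (Z (g i) j - P i j)\<^sup>2 + 2 * (P i j - Q i j)\<^sup>2)"
  proof (intro sum_mono)
    fix i j
    have "(x - z)\<^sup>2 \<le> 2 * (x - y)\<^sup>2 + 2 * (y - z)\<^sup>2" for x y z :: real
      using zero_le_power2[of "x - 2 * y + z"] by (simp add: power2_eq_square algebra_simps)
    then show "(Z (g i) j - Q i j)\<^sup>2 \<le> 2 * (Z (g i) j - P i j)\<^sup>2 + 2 * (P i j - Q i j)\<^sup>2" .
  qed
  also have "\<dots> = 2 * (\<Sum>i<s. \<Sum>j<s. (Z (g i) j - P i j)\<^sup>2) + 2 * (\<Sum>i<s. \<Sum>j<s. (P i j - Q i j)\<^sup>2)"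
    by (simp add: sum.distrib sum_distrib_left)
  also have "\<dots> \<le> 2 * ((1 + eps) * \<tau>) + 2 * (2 * \<tau>)"
    unfolding PQ using ZP by simp
  also have "\<dots> = (6 + 2 * eps) * \<tau>" by (simp add: algebra_simps)
  finally show thesis by (rule that)
qed

text \<open>The last claim moves one factor \<open>X\<close> across the scalar product and applies
  the eigenvector equation to a unit column.\<close>

lemma top_left_sing_vecs_orthonormal:
  assumes X: "X \<in> carrier_mat s d" and U: "top_left_sing_vecs r X U"
  defines "u \<equiv> \<lambda>l i. U $$ (i,l)"
  shows "U \<in> carrier_mat s r" and "orthonormal s r u"
    and "l < r \<Longrightarrow> (\<Sum>m<d. (ip s (u l) (\<lambda>i. X $$ (i,m)))\<^sup>2) = (sing_val X (Suc l))\<^sup>2"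
proof -
  show Uc: "U \<in> carrier_mat s r" using U X by (simp add: top_left_sing_vecs_def)
  have UU: "U\<^sup>T * U = 1\<^sub>m r" using U by (simp add: top_left_sing_vecs_def)
  show orth: "orthonormal s r u"
    unfolding orthonormal_def
  proof (intro allI impI)
    fix k l assume kl: "k < r" "l < r"
    have "(U\<^sup>T * U) $$ (k,l) = (if k = l then 1 else 0)" using kl by (simp add: UU)
    then show "ip s (u k) (u l) = (if k = l then 1 else 0)" using kl Uc
      by (simp add: ip_def u_def scalar_prod_def lessThan_atLeast0)
  qed
  show "(\<Sum>m<d. (ip s (u l) (\<lambda>i. X $$ (i,m)))\<^sup>2) = (sing_val X (Suc l))\<^sup>2" if l: "l < r"
  proof -
    define w where "w = col U l"
    have w: "w \<in> carrier_vec s" using col_dim[of U l] carrier_matD(1)[OF Uc] by (simp add: w_def)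
    have ev: "(X * X\<^sup>T) *\<^sub>v w = (sing_val X (Suc l))\<^sup>2 \<cdot>\<^sub>v w"
      using U l by (simp add: top_left_sing_vecs_def w_def)
    have "(\<Sum>m<d. (ip s (u l) (\<lambda>i. X $$ (i,m)))\<^sup>2) = (X\<^sup>T *\<^sub>v w) \<bullet> (X\<^sup>T *\<^sub>v w)"
      using X Uc l by (simp add: scalar_prod_def lessThan_atLeast0 ip_def u_def w_def power2_eq_square mult.commute)
    also have "\<dots> = w \<bullet> (X *\<^sub>v (X\<^sup>T *\<^sub>v w))"
      using transpose_vec_mult_scalar[of X s d "X\<^sup>T *\<^sub>v w" w] X w by simp
    also have "X *\<^sub>v (X\<^sup>T *\<^sub>v w) = (X * X\<^sup>T) *\<^sub>v w"
      using X w by (simp add: assoc_mult_mat_vec[of _ s d _ s])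
    also have "w \<bullet> \<dots> = (sing_val X (Suc l))\<^sup>2 * (w \<bullet> w)"
      unfolding ev using w by simp
    also have "w \<bullet> w = ip s (u l) (u l)"
      using Uc l by (simp add: scalar_prod_def lessThan_atLeast0 ip_def u_def w_def)
    finally show ?thesis using orth l by (simp add: orthonormal_def)
  qed
qed

theorem theorem1:
  fixes s n p r :: nat
    and A B :: "nat \<Rightarrow> real mat" and T :: "real mat"
    and Om :: "nat \<Rightarrow> nat set"
    and eA eB eT aA aB aT eps :: real
    and U :: "real mat" and g :: "nat \<Rightarrow> nat"
  defines "Phi \<equiv> feature_mat s n p aA aB aT A B T"
  defines "Phibar \<equiv> averaged_mat r Om Phi"
  defines "eAgg \<equiv> sqrt (aA^2 * eA^2 + aB^2 * eB^2 + aT^2 * eT^2)"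
  defines "Omax \<equiv> real (Max (card ` Om ` {..<r}))"
  defines "Omin \<equiv> real (Min (card ` Om ` {..<r}))"
  assumes "0 < s"
    and "\<forall>i<s. A i \<in> carrier_mat n n \<and> B i \<in> carrier_mat n p"
    and "ergodic_transition s T"
    and "is_partition s r Om"
    and "0 \<le> eA" "0 \<le> eB" "0 \<le> eT"
    and "(\<Sum>k<r. \<Sum>i\<in>Om k. \<Sum>i'\<in>Om k. fro_norm (A i - A i')) \<le> eA"
    and "(\<Sum>k<r. \<Sum>i\<in>Om k. \<Sum>i'\<in>Om k. fro_norm (B i - B i')) \<le> eB"
    and "(\<Sum>k<r. \<Sum>i\<in>Om k. \<Sum>i'\<in>Om k. row_l1_dist T i i') \<le> eT"
    and "0 \<le> aA" "0 \<le> aB" "0 \<le> aT" "aA + aB + aT = 1"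
    and "0 \<le> eps"
    and "top_left_sing_vecs r Phi U"
    and "kmeans_approx eps r U g"
    and "mat_rank Phibar = r"
  shows "(eAgg \<le> sing_val Phibar r * sqrt (Omin + Omax) / (8 * sqrt ((2 + eps) * Omax))
            \<longrightarrow> misclust_rate r Om g \<le> 64 * (2 + eps) * eAgg\<^sup>2 / (sing_val Phibar r)\<^sup>2)
       \<and> (eAgg \<le> sing_val Phibar r / (8 * sqrt ((2 + eps) * Omax))
            \<longrightarrow> misclust_rate r Om g = 0)"
proof -
  note part = assms(9) and eps = assms(20)
  let ?d = "n*n+n*p+s"
  have T: "T \<in> carrier_mat s s" using assms(8) by (simp add: ergodic_transition_def)
  have Phi: "Phi \<in> carrier_mat s ?d" by (simp add: Phi_def feature_mat_def)
  then have Phibar: "Phibar \<in> carrier_mat s ?d" by (simp add: Phibar_def averaged_mat_def)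
  have r: "0 < r" "r \<le> s"
    using part \<open>0 < s\<close> partition_le[OF part] by (auto simp: is_partition_def intro!: gr0I)
  define \<sigma> where "\<sigma> = sing_val Phibar r"
  have \<sigma>: "0 < \<sigma>" unfolding \<sigma>_def by (rule sing_val_rank_pos[OF Phibar r assms(23)])
  note U = top_left_sing_vecs_orthonormal[OF Phi assms(21)]
  define \<tau> where "\<tau> = real r - (\<Sum>l<r. \<Sum>k<r. (ip s (\<lambda>i. U $$ (i,l)) (cluster_vec Om k))\<^sup>2)"
  have "\<sigma>\<^sup>2 * \<tau> \<le> 4 * (\<Sum>m<?d. \<Sum>i<s. (Phi $$ (i,m) - Phibar $$ (i,m))\<^sup>2)"
    unfolding \<sigma>_def \<tau>_def
    by (rule sin_theta_bound[OF Phi Phibar r U(2) orthonormal_cluster_vec[OF part] U(3)])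
      (use \<sigma> averaged_mat_eq_proj[OF part Phi] in \<open>simp_all add: \<sigma>_def Phibar_def\<close>)
  moreover have "2 * (\<Sum>m<?d. \<Sum>i<s. (Phi $$ (i,m) - Phibar $$ (i,m))\<^sup>2) \<le> eAgg\<^sup>2"
    using feature_deviation_bound[OF assms(7) T part assms(13,14,15), of aA aB aT]
    by (simp add: eAgg_def Phi_def Phibar_def)
  ultimately have "\<sigma>\<^sup>2 * \<tau> \<le> 2 * eAgg\<^sup>2" by linarith
  \<comment> \<open>The claimed bound is \<open>64 * W\<close>; the row errors will be at most
    \<open>6 * W\<close>, which leads to \<open>24 * W\<close>.\<close>
  define W where "W = (2 + eps) * (eAgg\<^sup>2 / \<sigma>\<^sup>2)"
  have "\<tau> \<le> 2 * (eAgg\<^sup>2 / \<sigma>\<^sup>2)"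
    using \<open>\<sigma>\<^sup>2 * \<tau> \<le> 2 * eAgg\<^sup>2\<close> \<sigma> by (simp add: field_simps)
  then have "(6 + 2 * eps) * \<tau> \<le> (6 + 2 * eps) * (2 * (eAgg\<^sup>2 / \<sigma>\<^sup>2))"
    using eps by (intro mult_left_mono) auto
  also have "\<dots> \<le> (3 * (2 + eps)) * (2 * (eAgg\<^sup>2 / \<sigma>\<^sup>2))"
    using eps by (intro mult_right_mono) auto
  also have "\<dots> = 6 * W"
  proof -
    have "3 * (2 + e) * (2 * x) = 6 * ((2 + e) * x)" for e x :: real by (simp add: algebra_simps)
    then show ?thesis unfolding W_def .
  qed
  finally have \<tau>: "(6 + 2 * eps) * \<tau> \<le> 6 * W" .
  have W0: "0 \<le> W" using eps by (simp add: W_def)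
  obtain Z where Z: "(\<Sum>i<s. \<Sum>j<s. (Z (g i) j
      - (if j \<in> Om (clus_of r Om i) then 1 / real (card (Om (clus_of r Om i))) else 0))\<^sup>2) \<le> 6 * W"
    using kmeans_row_errors[OF part U(1,2) assms(22) eps] \<tau> unfolding \<tau>_def by (meson order_trans)
  have g: "\<forall>i<s. g i < r"
    using assms(22) U(1) by (simp add: kmeans_approx_def is_assignment_def)
  note rate = misclust_rate_from_row_errors[OF part r(1) g Z, folded Omax_def Omin_def]
  have "1 \<le> card (Om 0)" using partition_card_pos[OF part r(1)] by simp
  also have "card (Om 0) \<le> Max (card ` Om ` {..<r})" using r by (intro Max_ge) auto
  finally have Omax: "1 \<le> Omax" by (simp add: Omax_def)
  have Omin: "0 \<le> Omin" by (simp add: Omin_def)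
  have e0: "0 \<le> eAgg" by (simp add: eAgg_def)
  \<comment> \<open>Both smallness hypotheses are instances of this form, with
    \<open>t = Omin + Omax\<close> and \<open>t = 1\<close>.\<close>
  have square: "64 * W \<le> t / Omax" if "0 \<le> t" "eAgg \<le> \<sigma> * sqrt t / (8 * sqrt ((2 + eps) * Omax))" for t
  proof -
    have "eAgg\<^sup>2 \<le> (\<sigma> * sqrt t / (8 * sqrt ((2 + eps) * Omax)))\<^sup>2"
      using that e0 by (intro power_mono)
    also have "\<dots> = \<sigma>\<^sup>2 * t / (64 * ((2 + eps) * Omax))"
      using that(1) eps Omax by (simp add: power_divide power_mult_distrib)
    finally have "eAgg\<^sup>2 \<le> \<sigma>\<^sup>2 * t / (64 * ((2 + eps) * Omax))" .
    moreover have "0 < 64 * ((2 + eps) * Omax)" using eps Omax by simp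
    ultimately have "eAgg\<^sup>2 * (64 * ((2 + eps) * Omax)) \<le> \<sigma>\<^sup>2 * t" by (simp only: pos_le_divide_eq)
    moreover have W\<sigma>: "W * \<sigma>\<^sup>2 = (2 + eps) * eAgg\<^sup>2" using \<sigma> by (simp add: W_def)
    have "64 * W * Omax * \<sigma>\<^sup>2 = 64 * Omax * (W * \<sigma>\<^sup>2)" by (simp only: mult_ac)
    then have "64 * W * Omax * \<sigma>\<^sup>2 = eAgg\<^sup>2 * (64 * ((2 + eps) * Omax))"
      unfolding W\<sigma> by (simp only: mult_ac)
    ultimately have "64 * W * Omax * \<sigma>\<^sup>2 \<le> t * \<sigma>\<^sup>2" by (simp only: mult.commute[of t])
    then have "64 * W * Omax \<le> t" using \<sigma> by (simp only: mult_le_cancel_right_pos zero_less_power)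
    then show ?thesis using Omax by (simp add: pos_le_divide_eq)
  qed
  show ?thesis
  proof (intro conjI impI)
    assume "eAgg \<le> sing_val Phibar r * sqrt (Omin + Omax) / (8 * sqrt ((2 + eps) * Omax))"
    then have "64 * W \<le> (Omin + Omax) / Omax"
      using Omin Omax by (intro square) (auto simp: \<sigma>_def)
    then have "64 * W \<le> 1 + Omin / Omax" using Omax by (simp add: add_divide_distrib)
    moreover have "0 \<le> Omin / Omax" using Omin Omax by simp
    \<comment> \<open>The gap between 24 and 64, with a positive right side, turns the weak
      hypothesis into the strict inequality required.\<close>
    ultimately have "4 * (6 * W) < 1 + Omin / Omax" by linarith
    then have "misclust_rate r Om g \<le> 4 * (6 * W)" by (rule rate(1))
    also have "\<dots> \<le> 64 * W" using W0 by simp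
    finally show "misclust_rate r Om g \<le> 64 * (2 + eps) * eAgg\<^sup>2 / (sing_val Phibar r)\<^sup>2"
      by (simp only: W_def \<sigma>_def mult.assoc times_divide_eq_right)
  next
    assume "eAgg \<le> sing_val Phibar r / (8 * sqrt ((2 + eps) * Omax))"
    then have W: "64 * W \<le> 1 / Omax" by (intro square) (auto simp: \<sigma>_def)
    moreover have "0 < 1 / Omax" "1 / Omax \<le> 1" "0 \<le> Omin / Omax" using Omin Omax by auto
    ultimately have "4 * (6 * W) < 1 / Omax" "4 * (6 * W) < 1 + Omin / Omax" by linarith+
    then show "misclust_rate r Om g = 0" using rate(2) by blast
  qed
qed

end
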